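(* Let $n\ge3$ and let $w\in\widetilde{S}_n$ contain the pattern $4231$. Then the Poincaré polynomial $P_w(q)$ is not palindromic.
   Context: $\widetilde{S}_n$ is the set of bijections $w:\mathbb{Z}\to\mathbb{Z}$ with $w(i+n)=w(i)+n$ and $\sum_{i=1}^n w(i)=\binom{n+1}{2}$, viewed as the affine Weyl group of type $\widetilde{A}_{n-1}$ with length $\ell$ and Bruhat order. $P_w(q)=\sum_{v\le w}q^{\ell(v)}$, palindromic if $P_w(q)=q^{\ell(w)}P_w(q^{-1})$. $w$ contains $p\in S_k$ if there exist integers $i_1<\dots<i_k$ with $w(i_1),\dots,w(i_k)$ in the same relative order as $p$. *)

theory Defs
  imports "HOL-Computational_Algebra.Polynomial"
begin

definition affine_sym :: "nat \<Rightarrow> (int \<Rightarrow> int) set" where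
  "affine_sym n = {w. bij w \<and> (\<forall>i. w (i + int n) = w i + int n) \<and>
     (\<Sum>i = 1..int n. w i) = int ((n + 1) choose 2)}"

(* The Coxeter generators are s_0, ..., s_(n-1), where s_i exchanges i + kn and i + 1 + kn
   for every integer k. *)
definition simple_refl :: "nat \<Rightarrow> nat \<Rightarrow> int \<Rightarrow> int" where
  "simple_refl n i m =
     (if m mod int n = int i mod int n then m + 1
      else if m mod int n = (int i + 1) mod int n then m - 1
      else m)"

definition word_prod :: "nat \<Rightarrow> nat list \<Rightarrow> int \<Rightarrow> int" where
  "word_prod n is = foldr (\<circ>) (map (simple_refl n) is) id"

definition coxeter_length :: "nat \<Rightarrow> (int \<Rightarrow> int) \<Rightarrow> nat" where
  "coxeter_length n w = (LEAST k. \<exists>is. length is = k \<and> set is \<subseteq> {..<n} \<and> word_prod n is = w)"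

definition reflections :: "nat \<Rightarrow> (int \<Rightarrow> int) set" where
  "reflections n = {u \<circ> simple_refl n i \<circ> inv u | u i. u \<in> affine_sym n \<and> i < n}"

definition bruhat_step :: "nat \<Rightarrow> (int \<Rightarrow> int) \<Rightarrow> (int \<Rightarrow> int) \<Rightarrow> bool" where
  "bruhat_step n u v \<longleftrightarrow> u \<in> affine_sym n \<and>
     (\<exists>t \<in> reflections n. v = u \<circ> t) \<and> coxeter_length n u < coxeter_length n v"

definition bruhat_le :: "nat \<Rightarrow> (int \<Rightarrow> int) \<Rightarrow> (int \<Rightarrow> int) \<Rightarrow> bool" where
  "bruhat_le n = (bruhat_step n)\<^sup>*\<^sup>*"

(* Lower Bruhat intervals are finite, so the sum is a genuine one.  The integer coefficients
   are taken in the rationals, so that the polynomial can be evaluated at 1/q below. *)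
definition poincare_poly :: "nat \<Rightarrow> (int \<Rightarrow> int) \<Rightarrow> rat poly" where
  "poincare_poly n w =
     (\<Sum>v \<in> {v \<in> affine_sym n. bruhat_le n v w}. monom 1 (coxeter_length n v))"

(* The Laurent polynomial identity P(q) = q^l(w) P(1/q), read as an identity of functions on
   the nonzero rationals; the two readings agree because the field is infinite. *)
definition palindromic :: "nat \<Rightarrow> (int \<Rightarrow> int) \<Rightarrow> bool" where
  "palindromic n w \<longleftrightarrow> (\<forall>q. q \<noteq> 0 \<longrightarrow>
     poly (poincare_poly n w) q = q ^ coxeter_length n w * poly (poincare_poly n w) (inverse q))"

(* The pattern p is a permutation of {1..k} in one-line notation, k = length p. *)
definition contains_pattern :: "(int \<Rightarrow> int) \<Rightarrow> nat list \<Rightarrow> bool" where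
  "contains_pattern w p \<longleftrightarrow> (\<exists>i :: nat \<Rightarrow> int. strict_mono_on {..<length p} i \<and>
     (\<forall>a < length p. \<forall>b < length p. w (i a) < w (i b) \<longleftrightarrow> p ! a < p ! b))"

end

theory Submission
  imports Defs "HOL-Library.Function_Algebras"
begin

text \<open>
  A palindromic \<open>P\<^sub>w\<close> has as many elements of length one below \<open>w\<close> as coatoms; the pattern
  \<open>4231\<close> forces more coatoms than that.

  The coatoms of \<open>w\<close> are the products \<open>w t\<close> with the transposition \<open>t\<close> of a covering inversion
  \<open>(i, j)\<close>, to which one attaches the root \<open>\<alpha>\<^sub>i + \<dots> + \<alpha>\<^bsub>j-1\<^esub>\<close>.  Splitting an inversion at an
  intermediate position, and writing a long inversion as a convex combination of two of its
  translates, one sees that the roots of the coatoms span the roots of all inversions, hence every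
  simple root \<open>\<alpha>\<^sub>k\<close> with \<open>s\<^sub>k \<le> w\<close>.  These are linearly independent, so there are at least as many
  coatoms as elements of length one, and it remains to find a linear relation between the roots of
  the coatoms.  An occurrence \<open>a < b < c < d\<close> of \<open>4231\<close> gives two decompositions of the root of
  \<open>(a, d)\<close>, through \<open>b\<close> and through \<open>c\<close>.  Since \<open>w i - i\<close> drops along inversions and only depends
  on the class of \<open>i\<close>, coverings starting in the class of \<open>a\<close> enter only into the expressions of
  \<open>(a, b)\<close> and \<open>(a, c)\<close>.  If \<open>c - a\<close> is minimal, then \<open>(a, b)\<close> contributes a single such covering,
  whereas \<open>(a, c)\<close> contributes a different one or a proper convex combination of two.
\<close>

section \<open>Affine permutations and affine transpositions\<close>

text \<open>Membership in \<open>affine_sym n\<close> without the normalisation of the sum;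
  inversions and coverings are studied at this level of generality.\<close>

definition periodic_bij :: "nat \<Rightarrow> (int \<Rightarrow> int) \<Rightarrow> bool" where
  "periodic_bij n w \<longleftrightarrow> bij w \<and> (\<forall>i. w (i + int n) = w i + int n)"

lemma periodic_bij_shift:
  assumes "periodic_bij n w"
  shows "w (i + m * int n) = w i + m * int n"
proof -
  have step: "w (i + int n) = w i + int n" for i
    using assms by (simp add: periodic_bij_def)
  have step_down: "w (i - int n) = w i - int n" for i
    using step[of "i - int n"] by simp
  show ?thesis
  proof (induction m rule: int_induct[of _ 0])
    case (step1 m)
    then show ?case using step[of "i + m * int n"] by (simp add: algebra_simps)
  next
    case (step2 m)
    then show ?case using step_down[of "i + m * int n"] by (simp add: algebra_simps)
  qed simp
qed

lemma periodic_bij_inj: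
  assumes "periodic_bij n w"
  shows "w i = w j \<longleftrightarrow> i = j"
  using assms by (auto simp: periodic_bij_def bij_def inj_eq)

lemma periodic_bij_dvd:
  assumes "periodic_bij n w"
  shows "int n dvd w i - w j \<longleftrightarrow> int n dvd i - j"
proof
  assume "int n dvd i - j"
  then obtain m where "i = j + m * int n"
    by (metis add_diff_cancel_left' diff_add_cancel dvd_def mult.commute add.commute)
  then show "int n dvd w i - w j"
    using periodic_bij_shift[OF assms, of j m] by simp
next
  assume "int n dvd w i - w j"
  then obtain m where "w i = w j + m * int n"
    by (metis add_diff_cancel_left' diff_add_cancel dvd_def mult.commute add.commute)
  then have "w i = w (j + m * int n)"
    using periodic_bij_shift[OF assms, of j m] by simp
  then show "int n dvd i - j"
    using periodic_bij_inj[OF assms] by simp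
qed

lemma periodic_bij_comp:
  "periodic_bij n u \<Longrightarrow> periodic_bij n v \<Longrightarrow> periodic_bij n (u \<circ> v)"
  by (auto simp: periodic_bij_def bij_comp)

lemma periodic_bij_inv:
  assumes "periodic_bij n u"
  shows "periodic_bij n (inv u)"
proof -
  have b: "bij u" using assms by (simp add: periodic_bij_def)
  have "inv u (i + int n) = inv u i + int n" for i
  proof -
    have "u (inv u i + int n) = i + int n"
      using assms b by (simp add: periodic_bij_def bij_is_surj surj_f_inv_f)
    then show ?thesis
      by (metis b bij_inv_eq_iff)
  qed
  then show ?thesis
    using b by (simp add: periodic_bij_def bij_imp_bij_inv)
qed

text \<open>\<open>v\<close> permutes the residue classes modulo \<open>n\<close>, and
  \<open>f\<close> depends only on the class.\<close>

lemma sum_periodic_bij: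
  fixes f :: "int \<Rightarrow> int"
  assumes n: "n > 0" and v: "periodic_bij n v" and f: "\<And>i. f (i + int n) = f i"
  shows "(\<Sum>i = 1..int n. f (v i)) = (\<Sum>i = 1..int n. f i)"
proof -
  \<comment> \<open>The representative of the class of \<open>m\<close> in
    \<open>{1..int n}\<close>; the shift by one adapts the range of \<open>mod\<close>, which starts
    at 0.\<close>
  define r where "r m = (m - 1) mod int n + 1" for m
  have f_shift: "f (i + m * int n) = f i" for i m
  proof (induction m rule: int_induct[of _ 0])
    case (step1 m)
    then show ?case using f[of "i + m * int n"] by (simp add: algebra_simps)
  next
    case (step2 m)
    then show ?case using f[of "i + (m - 1) * int n"] by (simp add: algebra_simps)
  qed simp
  have r_eq: "m = r m + (m - 1) div int n * int n" for m
    using div_mult_mod_eq[of "m - 1" "int n"] unfolding r_def by linarith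
  have f_r: "f (r m) = f m" for m
    using f_shift[of "r m" "(m - 1) div int n"] r_eq[of m] by simp
  have r_in: "r m \<in> {1..int n}" for m
    using n pos_mod_bound[of "int n" "m - 1"] by (simp add: r_def del: pos_mod_bound)
  have "inj_on (r \<circ> v) {1..int n}"
  proof (rule inj_onI)
    fix i j assume ij: "i \<in> {1..int n}" "j \<in> {1..int n}" and "(r \<circ> v) i = (r \<circ> v) j"
    then have "int n dvd (v i - 1) - (v j - 1)"
      by (simp only: r_def o_def mod_eq_dvd_iff add_right_cancel)
    then have "int n dvd i - j"
      using periodic_bij_dvd[OF v] by simp
    then have "int n dvd \<bar>i - j\<bar>" by simp
    moreover have "\<bar>i - j\<bar> < int n" using ij by auto
    ultimately show "i = j"
      using zdvd_imp_le[of "int n" "\<bar>i - j\<bar>"] by linarith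
  qed
  then have "bij_betw (r \<circ> v) {1..int n} {1..int n}"
    by (intro bij_betw_imageI endo_inj_surj) (use r_in in auto)
  from sum.reindex_bij_betw[OF this, of f] show ?thesis
    by (simp add: f_r)
qed

text \<open>Subtracting \<open>1 + ... + n\<close> turns the normalisation into a statement about
  \<open>w i - i\<close>, which is periodic, so that \<open>sum_periodic_bij\<close> applies to
  it.\<close>

lemma affine_sym_iff:
  "w \<in> affine_sym n \<longleftrightarrow> periodic_bij n w \<and> (\<Sum>i = 1..int n. w i - i) = 0"
proof -
  have "(\<Sum>i = 1..int n. i) = int ((n + 1) choose 2)"
  proof (induction n)
    case (Suc n)
    have "{1..int (Suc n)} = insert (int (Suc n)) {1..int n}" by auto
    then show ?case using Suc by (simp add: numeral_2_eq_2)
  qed simp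
  then show ?thesis
    by (auto simp: affine_sym_def periodic_bij_def sum_subtractf)
qed

lemma affine_sym_periodic: "w \<in> affine_sym n \<Longrightarrow> periodic_bij n w"
  by (simp add: affine_sym_iff)

lemma affine_sym_comp:
  assumes "n > 0" "u \<in> affine_sym n" "v \<in> affine_sym n"
  shows "u \<circ> v \<in> affine_sym n"
proof -
  have "(\<Sum>i = 1..int n. u (v i) - v i) = (\<Sum>i = 1..int n. u i - i)"
    using sum_periodic_bij[of n v "\<lambda>i. u i - i"] assms
    by (auto simp: affine_sym_iff periodic_bij_def)
  moreover have "(\<Sum>i = 1..int n. u (v i) - i)
      = (\<Sum>i = 1..int n. u (v i) - v i) + (\<Sum>i = 1..int n. v i - i)"
    by (simp add: sum.distrib[symmetric])
  ultimately show ?thesis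
    using assms by (simp add: affine_sym_iff periodic_bij_comp)
qed

text \<open>For \<open>i\<close> and \<open>j\<close> in different residue classes this is the
  product of the transpositions of \<open>i + k n\<close> and \<open>j + k n\<close> over all
  integers \<open>k\<close>.\<close>

definition affine_transp :: "nat \<Rightarrow> int \<Rightarrow> int \<Rightarrow> int \<Rightarrow> int" where
  "affine_transp n i j m =
     (if int n dvd m - i then m + (j - i)
      else if int n dvd m - j then m - (j - i)
      else m)"

lemma affine_transp_cases:
  assumes "\<not> int n dvd j - i"
  obtains (left) k where "m = i + k * int n" "affine_transp n i j m = j + k * int n"
  | (right) k where "m = j + k * int n" "affine_transp n i j m = i + k * int n"
  | (fixed) "\<not> int n dvd m - i" "\<not> int n dvd m - j" "affine_transp n i j m = m"
proof -
  consider "int n dvd m - i" | "\<not> int n dvd m - i" "int n dvd m - j"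
    | "\<not> int n dvd m - i" "\<not> int n dvd m - j" by blast
  then show thesis
  proof cases
    case 1
    then obtain k where "m - i = int n * k" by (auto simp: dvd_def)
    then show thesis using 1 by (intro left[of k]) (auto simp: affine_transp_def algebra_simps)
  next
    case 2
    then obtain k where "m - j = int n * k" by (auto simp: dvd_def)
    then show thesis using 2 by (intro right[of k]) (auto simp: affine_transp_def algebra_simps)
  next
    case 3
    then show thesis by (intro fixed) (auto simp: affine_transp_def)
  qed
qed

lemma affine_transp_left: "affine_transp n i j (i + k * int n) = j + k * int n"
  by (simp add: affine_transp_def)

lemma affine_transp_right:
  assumes "\<not> int n dvd j - i"
  shows "affine_transp n i j (j + k * int n) = i + k * int n"
proof -
  have "j + k * int n - i = (j - i) + k * int n" by simp
  then have "\<not> int n dvd j + k * int n - i"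
    using assms by (simp only: dvd_add_times_triv_right_iff) simp
  then show ?thesis by (simp add: affine_transp_def)
qed

lemma affine_transp_involution:
  assumes "\<not> int n dvd j - i"
  shows "affine_transp n i j (affine_transp n i j m) = m"
  using assms
proof (cases rule: affine_transp_cases[where m = m])
  case (left k)
  then show ?thesis using affine_transp_right[OF assms] by simp
next
  case (right k)
  then show ?thesis using affine_transp_left by simp
qed simp

lemma periodic_bij_affine_transp:
  assumes "\<not> int n dvd j - i"
  shows "periodic_bij n (affine_transp n i j)"
proof -
  have "bij (affine_transp n i j)"
    by (rule o_bij[where g = "affine_transp n i j"])
      (auto simp: affine_transp_involution[OF assms])
  moreover have "affine_transp n i j (m + int n) = affine_transp n i j m + int n" for m
  proof -
    have "int n dvd m + int n - x \<longleftrightarrow> int n dvd m - x" for x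
      by (metis add.commute add_diff_eq dvd_add_triv_left_iff)
    then show ?thesis by (simp add: affine_transp_def)
  qed
  ultimately show ?thesis by (simp add: periodic_bij_def)
qed

text \<open>Reindexing the sum of the displacements along the involution itself changes its sign, so
  it vanishes.\<close>

lemma affine_transp_in_affine_sym:
  assumes "n > 0" "\<not> int n dvd j - i"
  shows "affine_transp n i j \<in> affine_sym n"
proof -
  let ?t = "affine_transp n i j"
  have t: "periodic_bij n ?t" using periodic_bij_affine_transp assms by blast
  have "(\<Sum>m = 1..int n. ?t (?t m) - ?t m) = (\<Sum>m = 1..int n. ?t m - m)"
    using sum_periodic_bij[of n ?t "\<lambda>m. ?t m - m"] assms(1) t by (auto simp: periodic_bij_def)
  then have "(\<Sum>m = 1..int n. m - ?t m) = (\<Sum>m = 1..int n. ?t m - m)"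
    by (simp add: affine_transp_involution[OF assms(2)])
  then have "(\<Sum>m = 1..int n. ?t m - m) = 0"
    by (simp add: sum_subtractf)
  then show ?thesis using t by (simp add: affine_sym_iff)
qed

lemma affine_transp_conj:
  assumes u: "periodic_bij n u" and ij: "\<not> int n dvd j - i"
  shows "u \<circ> affine_transp n i j \<circ> inv u = affine_transp n (u i) (u j)"
proof
  fix m
  have b: "bij u" using u by (simp add: periodic_bij_def)
  obtain x where m: "m = u x" using b by (metis bij_pointE)
  then have x: "inv u m = x" using b by (simp add: bij_is_inj)
  have "u (affine_transp n i j x) = affine_transp n (u i) (u j) (u x)"
    using ij
  proof (cases rule: affine_transp_cases[where m = x])
    case (left k)
    then show ?thesis
      using affine_transp_left periodic_bij_shift[OF u] by simp
  next
    case (right k)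
    have "\<not> int n dvd u j - u i" using periodic_bij_dvd[OF u] ij by simp
    then show ?thesis
      using right affine_transp_right periodic_bij_shift[OF u] by simp
  next
    case fixed
    then show ?thesis
      using periodic_bij_dvd[OF u] by (simp add: affine_transp_def)
  qed
  then show "(u \<circ> affine_transp n i j \<circ> inv u) m = affine_transp n (u i) (u j) m"
    by (simp only: o_apply x) (simp only: m)
qed

lemma affine_transp_shift:
  "affine_transp n (i + k * int n) (j + k * int n) = affine_transp n i j"
proof -
  have "int n dvd m - (x + k * int n) \<longleftrightarrow> int n dvd m - x" for m x
    by (metis diff_diff_eq dvd_diff_left_iff dvd_triv_right)
  then show ?thesis by (auto simp: affine_transp_def)
qed

lemma affine_transp_commute:
  assumes "\<not> int n dvd j - i"
  shows "affine_transp n j i = affine_transp n i j"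
proof
  fix m
  have "\<not> (int n dvd m - i \<and> int n dvd m - j)"
    using assms dvd_diff[of "int n" "m - i" "m - j"] by auto
  then show "affine_transp n j i m = affine_transp n i j m"
    by (auto simp: affine_transp_def)
qed

lemma not_dvd_one: "n \<ge> 2 \<Longrightarrow> \<not> int n dvd 1"
  by (simp add: zdvd1_eq)

lemma simple_refl_eq: "simple_refl n i = affine_transp n (int i) (int i + 1)"
  by (rule ext) (simp add: simple_refl_def affine_transp_def mod_eq_dvd_iff)

lemma simple_refl_in_affine_sym: "n \<ge> 2 \<Longrightarrow> simple_refl n i \<in> affine_sym n"
  unfolding simple_refl_eq by (rule affine_transp_in_affine_sym) (auto simp: not_dvd_one)

lemma adjacent_affine_transp:
  assumes "n > 0"
  shows "affine_transp n k (k + 1) = simple_refl n (nat (k mod int n))"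
proof -
  have "int (nat (k mod int n)) = k mod int n" using assms by simp
  then show ?thesis
    using affine_transp_shift[of n "k mod int n" "k div int n" "k mod int n + 1"]
    by (simp add: simple_refl_eq algebra_simps)
qed

section \<open>Reflections as affine transpositions\<close>

lemma reflections_conj:
  assumes "n > 0" "t \<in> reflections n" "u \<in> affine_sym n"
  shows "u \<circ> t \<circ> inv u \<in> reflections n"
proof -
  obtain v i where v: "v \<in> affine_sym n" "i < n" "t = v \<circ> simple_refl n i \<circ> inv v"
    using assms by (auto simp: reflections_def)
  have "bij u" "bij v"
    using assms v affine_sym_periodic by (auto simp: periodic_bij_def)
  then have "inv (u \<circ> v) = inv v \<circ> inv u" by (rule o_inv_distrib)
  then have "u \<circ> t \<circ> inv u = (u \<circ> v) \<circ> simple_refl n i \<circ> inv (u \<circ> v)"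
    by (simp add: v(3) o_assoc)
  then show ?thesis
    using v assms affine_sym_comp unfolding reflections_def by blast
qed

lemma reflectionE:
  assumes "n \<ge> 2" "t \<in> reflections n"
  obtains i j where "i < j" "\<not> int n dvd j - i" "t = affine_transp n i j"
proof -
  obtain u k where u: "u \<in> affine_sym n" "t = u \<circ> simple_refl n k \<circ> inv u"
    using assms by (auto simp: reflections_def)
  let ?i = "u (int k)" and ?j = "u (int k + 1)"
  have p: "periodic_bij n u" using u affine_sym_periodic by blast
  have t: "t = affine_transp n ?i ?j"
    using u affine_transp_conj[OF p] not_dvd_one[OF assms(1)] by (simp add: simple_refl_eq)
  have nd: "\<not> int n dvd ?j - ?i"
    using periodic_bij_dvd[OF p] not_dvd_one[OF assms(1)] by simp
  then have "?i \<noteq> ?j" by auto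
  then consider "?i < ?j" | "?j < ?i" by linarith
  then show thesis
  proof cases
    case 1
    then show thesis using that nd t by blast
  next
    case 2
    have "\<not> int n dvd ?i - ?j" using nd by (metis dvd_minus_iff minus_diff_eq)
    then show thesis using that[OF 2] t affine_transp_commute[OF nd] by simp
  qed
qed

text \<open>Conjugation by generators shortens the distance \<open>j - i\<close> until the two
  positions are adjacent.\<close>

lemma affine_transp_in_reflections:
  assumes n: "n \<ge> 3"
  shows "i < j \<Longrightarrow> \<not> int n dvd j - i \<Longrightarrow> affine_transp n i j \<in> reflections n"
proof (induction "nat (j - i)" arbitrary: i j rule: less_induct)
  case less
  have conj: "affine_transp n i j \<in> reflections n"
    if "affine_transp n i' j' \<in> reflections n" "\<not> int n dvd j' - i'"
      "affine_transp n k (k + 1) i' = i" "affine_transp n k (k + 1) j' = j" for i' j' k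
  proof -
    let ?s = "affine_transp n k (k + 1)"
    have "\<not> int n dvd k + 1 - k" using n not_dvd_one by simp
    then have "?s \<in> affine_sym n" using affine_transp_in_affine_sym n by simp
    then show ?thesis
      using reflections_conj[of n "affine_transp n i' j'" ?s] affine_transp_conj[of n ?s j' i']
        that n affine_sym_periodic by simp
  qed
  consider "j = i + 1" | "j > i + 1" "\<not> int n dvd j - 1 - i" | "j > i + 1" "int n dvd j - 1 - i"
    using less.prems by linarith
  then show ?case
  proof cases
    case 1
    let ?k = "nat (i mod int n)"
    have "id \<circ> simple_refl n ?k \<circ> inv id = affine_transp n i j"
      using adjacent_affine_transp[of n i] n 1 by simp
    moreover have "id \<in> affine_sym n"
      by (simp add: affine_sym_iff periodic_bij_def)
    moreover have "?k < n" using n pos_mod_bound[of "int n" i] by (simp add: nat_less_iff)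
    ultimately show ?thesis unfolding reflections_def by (metis (mono_tags, lifting) mem_Collect_eq)
  next
    case 2
    have "affine_transp n i (j - 1) \<in> reflections n"
      using less.hyps[of "j - 1" i] 2 by (simp add: algebra_simps)
    moreover have "affine_transp n (j - 1) (j - 1 + 1) i = i"
      using 2(2) less.prems(2) dvd_diff_commute[of "int n" i j]
        dvd_diff_commute[of "int n" i "j - 1"]
      by (simp add: affine_transp_def)
    moreover have "affine_transp n (j - 1) (j - 1 + 1) (j - 1) = j"
      by (simp add: affine_transp_def)
    moreover have "\<not> int n dvd j - 1 - i" using 2 by simp
    ultimately show ?thesis by (intro conj)
  next
    case 3
    then obtain m where m: "j - 1 - i = int n * m" by (auto simp: dvd_def)
    then have m1: "m \<ge> 1" using 3 n
      by (smt (verit) mult_nonneg_nonpos of_nat_0_le_iff)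
    then have mn: "int n * m \<ge> int n" using n by (simp add: mult_le_cancel_left1)
    have nd2: "\<not> int n dvd (j - 1) - (i + 1)"
    proof
      assume "int n dvd (j - 1) - (i + 1)"
      from dvd_diff[OF 3(2) this]
      show False using not_dvd_one[of n] n by simp
    qed
    moreover have "affine_transp n (i + 1) (j - 1) \<in> reflections n"
      using less.hyps[of "j - 1" "i + 1"] nd2 mn m n by (simp add: algebra_simps)
    moreover have "affine_transp n i (i + 1) (i + 1) = i"
      using affine_transp_right[of n "i + 1" i 0] not_dvd_one[of n] n by simp
    moreover have "affine_transp n i (i + 1) (j - 1) = j"
      using 3 by (simp add: affine_transp_def)
    ultimately show ?thesis by (intro conj)
  qed
qed

section \<open>Inversions modulo translation\<close>

definition shift_pair :: "nat \<Rightarrow> int \<Rightarrow> int \<times> int \<Rightarrow> int \<times> int" where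
  "shift_pair n m p = (fst p + m * int n, snd p + m * int n)"

definition shift_invariant :: "nat \<Rightarrow> (int \<times> int) set \<Rightarrow> bool" where
  "shift_invariant n A \<longleftrightarrow> (\<forall>p\<in>A. \<forall>m. shift_pair n m p \<in> A)"

text \<open>For \<open>n > 0\<close> every translation orbit contains exactly one pair with first
  entry in this range, so the orbits of a \<open>shift_invariant\<close> set can be counted although
  such a set is infinite unless empty.\<close>

definition orbit_reps :: "nat \<Rightarrow> (int \<times> int) set \<Rightarrow> (int \<times> int) set" where
  "orbit_reps n A = {p \<in> A. 0 \<le> fst p \<and> fst p < int n}"

definition orbit_card :: "nat \<Rightarrow> (int \<times> int) set \<Rightarrow> nat" where
  "orbit_card n A = card (orbit_reps n A)"

lemma shift_pair_add: "shift_pair n m (shift_pair n k p) = shift_pair n (m + k) p"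
  by (simp add: shift_pair_def algebra_simps)

lemma shift_pair_0 [simp]: "shift_pair n 0 p = p"
  by (simp add: shift_pair_def)

lemma shift_rep_bounds:
  assumes "n > 0"
  shows "0 \<le> fst (shift_pair n (- (fst p div int n)) p)"
    "fst (shift_pair n (- (fst p div int n)) p) < int n"
proof -
  have "fst (shift_pair n (- (fst p div int n)) p) = fst p mod int n"
    by (simp add: shift_pair_def minus_div_mult_eq_mod)
  then show "0 \<le> fst (shift_pair n (- (fst p div int n)) p)"
    "fst (shift_pair n (- (fst p div int n)) p) < int n"
    using assms by simp_all
qed

lemma shift_rep_unique:
  assumes "0 \<le> fst p" "fst p < int n" "0 \<le> fst (shift_pair n m p)" "fst (shift_pair n m p) < int n"
  shows "m = 0"
proof (rule ccontr)
  assume "m \<noteq> 0"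
  then have "m \<ge> 1 \<or> m \<le> - 1" by linarith
  then have "m * int n \<ge> int n \<or> m * int n \<le> - int n"
    using mult_right_mono[of 1 m "int n"] mult_right_mono[of m "- 1" "int n"] by auto
  then show False using assms unfolding shift_pair_def fst_conv by linarith
qed

lemma shift_invariant_image:
  assumes "shift_invariant n A" "\<And>p m. p \<in> A \<Longrightarrow> G (shift_pair n m p) = shift_pair n m (G p)"
  shows "shift_invariant n (G ` A)"
  unfolding shift_invariant_def
proof (intro ballI allI)
  fix q m assume "q \<in> G ` A"
  then obtain p where "p \<in> A" "q = G p" by blast
  then have "shift_pair n m q = G (shift_pair n m p)" "shift_pair n m p \<in> A"
    using assms by (simp_all add: shift_invariant_def)
  then show "shift_pair n m q \<in> G ` A" by simp
qed

lemma shift_invariant_Diff: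
  assumes "shift_invariant n A" "shift_invariant n B"
  shows "shift_invariant n (A - B)"
proof -
  have "p \<in> B" if "shift_pair n m p \<in> B" for p m
  proof -
    have "shift_pair n (- m) (shift_pair n m p) \<in> B"
      using assms(2) that unfolding shift_invariant_def by blast
    then show ?thesis by (simp add: shift_pair_add)
  qed
  then show ?thesis using assms unfolding shift_invariant_def by blast
qed

text \<open>\<open>G\<close> sends orbits to orbits but need not respect the range of the
  representatives, so \<open>?H\<close> translates \<open>G p\<close> back into it.\<close>

lemma orbit_reps_bij_betw:
  assumes n: "n > 0" and A: "shift_invariant n A" and inj: "inj_on G A"
    and G: "\<And>p m. p \<in> A \<Longrightarrow> G (shift_pair n m p) = shift_pair n m (G p)"
  shows "bij_betw (\<lambda>p. shift_pair n (- (fst (G p) div int n)) (G p))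
           (orbit_reps n A) (orbit_reps n (G ` A))"
    (is "bij_betw ?H _ _")
proof (rule bij_betwI')
  fix p q assume p: "p \<in> orbit_reps n A" and q: "q \<in> orbit_reps n A"
  have pq: "p \<in> A" "q \<in> A" using p q by (auto simp: orbit_reps_def)
  show "?H p = ?H q \<longleftrightarrow> p = q"
  proof
    assume eq: "?H p = ?H q"
    let ?d = "fst (G p) div int n - fst (G q) div int n"
    have "G p = shift_pair n (fst (G p) div int n) (?H p)"
      by (simp add: shift_pair_add)
    also have "\<dots> = G (shift_pair n ?d q)"
      by (simp only: eq) (simp add: shift_pair_add G[OF pq(2)])
    finally have "p = shift_pair n ?d q"
      using inj pq A by (auto simp: inj_on_def shift_invariant_def)
    moreover from this have "?d = 0"
      using p q by (intro shift_rep_unique[of q n]) (auto simp: orbit_reps_def)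
    ultimately show "p = q" by simp
  qed simp
next
  fix p assume p: "p \<in> orbit_reps n A"
  then show "?H p \<in> orbit_reps n (G ` A)"
    using shift_invariant_image[OF A G] shift_rep_bounds[OF n]
    by (auto simp: orbit_reps_def shift_invariant_def)
next
  fix q assume q: "q \<in> orbit_reps n (G ` A)"
  then obtain p where p: "p \<in> A" "q = G p" by (auto simp: orbit_reps_def)
  define p0 where "p0 = shift_pair n (- (fst p div int n)) p"
  have p0: "p0 \<in> orbit_reps n A"
    using p A shift_rep_bounds[OF n] by (auto simp: orbit_reps_def p0_def shift_invariant_def)
  have "G p0 = shift_pair n (- (fst p div int n)) q"
    by (simp add: p0_def G p)
  then obtain m where m: "?H p0 = shift_pair n m q"
    by (simp add: shift_pair_add)
  moreover have "m = 0"
    using q shift_rep_bounds[OF n, of "G p0"] unfolding m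
    by (intro shift_rep_unique[of q n]) (auto simp: orbit_reps_def)
  ultimately show "\<exists>p\<in>orbit_reps n A. q = ?H p" using p0 by auto
qed

lemma orbit_card_image:
  assumes "n > 0" "shift_invariant n A" "inj_on G A"
    and "\<And>p m. p \<in> A \<Longrightarrow> G (shift_pair n m p) = shift_pair n m (G p)"
  shows "orbit_card n (G ` A) = orbit_card n A"
  using bij_betw_same_card[OF orbit_reps_bij_betw[OF assms]] by (simp add: orbit_card_def)

lemma finite_orbit_reps_image:
  assumes "n > 0" "shift_invariant n A" "inj_on G A"
    and "\<And>p m. p \<in> A \<Longrightarrow> G (shift_pair n m p) = shift_pair n m (G p)"
    and "finite (orbit_reps n A)"
  shows "finite (orbit_reps n (G ` A))"
  using bij_betw_finite[OF orbit_reps_bij_betw[OF assms(1-4)]] assms(5) by simp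

lemma orbit_card_Int_Diff:
  assumes "finite (orbit_reps n A)"
  shows "orbit_card n A = orbit_card n (A \<inter> B) + orbit_card n (A - B)"
proof -
  have "orbit_reps n A = orbit_reps n (A \<inter> B) \<union> orbit_reps n (A - B)"
    "orbit_reps n (A \<inter> B) \<inter> orbit_reps n (A - B) = {}"
    by (auto simp: orbit_reps_def)
  then show ?thesis
    using card_Un_disjoint[of "orbit_reps n (A \<inter> B)" "orbit_reps n (A - B)"] assms
    by (simp add: orbit_card_def)
qed

section \<open>Inversions and the effect of a transposition on their number\<close>

definition inversions :: "(int \<Rightarrow> int) \<Rightarrow> (int \<times> int) set" where
  "inversions w = {(i, j). i < j \<and> w j < w i}"

definition inv_num :: "nat \<Rightarrow> (int \<Rightarrow> int) \<Rightarrow> nat" where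
  "inv_num n w = orbit_card n (inversions w)"

lemma shift_invariant_inversions:
  "periodic_bij n w \<Longrightarrow> shift_invariant n (inversions w)"
  by (auto simp: shift_invariant_def inversions_def shift_pair_def periodic_bij_shift)

text \<open>The displacement \<open>w x - x\<close> is periodic, hence bounded by some
  \<open>C\<close>, so an inversion \<open>(x, y)\<close> satisfies
  \<open>y - x <= 2 * C\<close>.\<close>

lemma finite_inversion_reps:
  assumes n: "n > 0" and w: "periodic_bij n w"
  shows "finite (orbit_reps n (inversions w))"
proof -
  define C where "C = Max ((\<lambda>x. \<bar>w x - x\<bar>) ` {0..<int n})"
  have C: "\<bar>w x - x\<bar> \<le> C" for x
  proof -
    have "w x = w (x mod int n) + (x div int n) * int n"
      using periodic_bij_shift[OF w, of "x mod int n" "x div int n"] by simp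
    then have "w x - x = w (x mod int n) - x mod int n"
      using div_mult_mod_eq[of x "int n"] by linarith
    then show ?thesis using n by (simp add: C_def)
  qed
  have "orbit_reps n (inversions w) \<subseteq> {0..<int n} \<times> {0..int n + 2 * C}"
  proof
    fix p assume "p \<in> orbit_reps n (inversions w)"
    then obtain x y where p: "p = (x, y)" "0 \<le> x" "x < int n" "x < y" "w y < w x"
      by (cases p) (auto simp: orbit_reps_def inversions_def)
    then have "y \<le> int n + 2 * C" using C[of x] C[of y] by linarith
    then show "p \<in> {0..<int n} \<times> {0..int n + 2 * C}" using p by auto
  qed
  then show ?thesis by (rule finite_subset) auto
qed

text \<open>The inversions whose transposition lowers the length by exactly one.  The third conjunct has
  no counterpart in the finite symmetric groups: if it fails, then translating \<open>j\<close> by \<open>n\<close> in either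
  direction gives further inversions that the transposition destroys as well.\<close>

definition covering :: "nat \<Rightarrow> (int \<Rightarrow> int) \<Rightarrow> int \<Rightarrow> int \<Rightarrow> bool" where
  "covering n w i j \<longleftrightarrow> i < j \<and> w j < w i \<and> (j - i < int n \<or> w i - w j < int n) \<and>
     (\<forall>k. i < k \<and> k < j \<longrightarrow> \<not> (w j < w k \<and> w k < w i))"

lemma inversion_not_dvd:
  assumes w: "periodic_bij n w" and "i < j" "w j < w i"
  shows "\<not> int n dvd j - i"
proof
  assume "int n dvd j - i"
  then obtain m where m: "j = i + m * int n" by (auto simp: dvd_def algebra_simps)
  then show False using assms periodic_bij_shift[OF w, of i m] by simp
qed

text \<open>Passing from \<open>w\<close> to \<open>w \<circ> t\<close> gains the inversions \<open>up\<close> and loses \<open>down\<close>.  The involution \<open>G\<close>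
  maps \<open>up\<close> into \<open>down\<close>, and for a covering it misses only the orbit of \<open>(i, j)\<close>.\<close>

context
  fixes n :: nat and w :: "int \<Rightarrow> int" and i j :: int and t :: "int \<Rightarrow> int"
    and up down :: "(int \<times> int) set" and G :: "int \<times> int \<Rightarrow> int \<times> int"
  assumes n: "n > 0" and w: "periodic_bij n w" and ij: "i < j" "w j < w i"
  defines "t \<equiv> affine_transp n i j"
    and "up \<equiv> {(x, y). x < y \<and> t y < t x \<and> w x < w y}"
    and "down \<equiv> {(x, y). x < y \<and> t y < t x \<and> w y < w x}"
    and "G \<equiv> (\<lambda>(x, y). (t y, t x))"
begin

private lemma nd: "\<not> int n dvd j - i"
  using inversion_not_dvd w ij by blast

private lemma t: "periodic_bij n t"
  unfolding t_def by (rule periodic_bij_affine_transp[OF nd])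

private lemma tt [simp]: "t (t x) = x"
  unfolding t_def by (rule affine_transp_involution[OF nd])

private lemma t_eq_iff [simp]: "t x = t y \<longleftrightarrow> x = y"
  using periodic_bij_inj[OF t] .

private lemma w_eq_iff [simp]: "w x = w y \<longleftrightarrow> x = y"
  using periodic_bij_inj[OF w] .

private lemma shift_up: "shift_invariant n up" and shift_down: "shift_invariant n down"
  by (auto simp: up_def down_def shift_invariant_def shift_pair_def
      periodic_bij_shift[OF t] periodic_bij_shift[OF w])

private lemma G_shift: "G (shift_pair n m p) = shift_pair n m (G p)"
  by (auto simp: G_def shift_pair_def periodic_bij_shift[OF t] split: prod.splits)

private lemma G_involution [simp]: "G (G p) = p"
  by (simp add: G_def split: prod.splits)

private lemma G_inj: "inj_on G A"
  by (metis G_involution inj_onI)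

private lemma finite_down: "finite (orbit_reps n down)"
  by (rule finite_subset[OF _ finite_inversion_reps[OF n w]])
    (auto simp: orbit_reps_def down_def inversions_def)

text \<open>\<open>J\<close> consists of the inversions of \<open>w \<circ> t\<close> carried over
  by \<open>t\<close>, which makes them comparable with those of \<open>w\<close>: the ones lost
  form \<open>down\<close>, the ones gained form \<open>up\<close> with the entries swapped.\<close>

private lemma inv_num_comp:
  "inv_num n (w \<circ> t) + orbit_card n down = inv_num n w + orbit_card n up"
proof -
  define J where "J = {(x, y). t x < t y \<and> w y < w x}"
  have wt: "periodic_bij n (w \<circ> t)" using periodic_bij_comp w t by blast
  have J: "J = map_prod t t ` inversions (w \<circ> t)"
  proof
    show "J \<subseteq> map_prod t t ` inversions (w \<circ> t)"
    proof
      fix p assume "p \<in> J"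
      then have "map_prod t t p \<in> inversions (w \<circ> t)" "p = map_prod t t (map_prod t t p)"
        by (auto simp: J_def inversions_def)
      then show "p \<in> map_prod t t ` inversions (w \<circ> t)" by (rule rev_image_eqI)
    qed
  qed (auto simp: J_def inversions_def)
  have inj: "inj_on (map_prod t t) (inversions (w \<circ> t))"
    by (auto simp: inj_on_def)
  have map_shift: "map_prod t t (shift_pair n m p) = shift_pair n m (map_prod t t p)" for m p
    by (cases p) (simp add: shift_pair_def periodic_bij_shift[OF t])
  note I = shift_invariant_inversions[OF wt]
  have "orbit_card n J = inv_num n (w \<circ> t)"
    unfolding J inv_num_def using orbit_card_image[OF n I inj map_shift] by simp
  moreover have "finite (orbit_reps n J)"
    unfolding J using finite_orbit_reps_image[OF n I inj map_shift finite_inversion_reps[OF n wt]]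
    by simp
  then have "orbit_card n J = orbit_card n (J \<inter> inversions w) + orbit_card n (J - inversions w)"
    by (rule orbit_card_Int_Diff)
  moreover have "inv_num n w = orbit_card n (inversions w \<inter> J) + orbit_card n (inversions w - J)"
    unfolding inv_num_def by (rule orbit_card_Int_Diff[OF finite_inversion_reps[OF n w]])
  moreover have "inversions w - J = down"
    using t_eq_iff by (fastforce simp: J_def inversions_def down_def not_less order_less_le)
  moreover have "J - inversions w = prod.swap ` up"
  proof -
    have "J - inversions w = {(x, y). y < x \<and> t x < t y \<and> w y < w x}"
      by (auto simp: J_def inversions_def not_less order_less_le)
    then show ?thesis by (force simp: up_def)
  qed
  moreover have "orbit_card n (prod.swap ` up) = orbit_card n up"
    by (rule orbit_card_image[OF n shift_up]) (auto simp: shift_pair_def)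
  ultimately show ?thesis by (simp add: Int_commute)
qed

private lemma t_cases:
  obtains (left) k where "x = i + k * int n" "t x = j + k * int n"
    "w x = w i + k * int n" "w (t x) = w j + k * int n"
  | (right) k where "x = j + k * int n" "t x = i + k * int n"
    "w x = w j + k * int n" "w (t x) = w i + k * int n"
  | (fixed) "t x = x"
  using affine_transp_cases[OF nd, of x] unfolding t_def
  by (metis periodic_bij_shift[OF w])

text \<open>All moves of \<open>t\<close> have size 0 or \<open>j - i\<close>, so reversing
  \<open>x < y\<close> forces \<open>t x >= x\<close> and \<open>t y <= y\<close>. Moving right
  lowers the value and moving left raises it, hence
  \<open>w (t x) <= w x < w y <= w (t y)\<close>.\<close>

private lemma G_up: "G ` up \<subseteq> down"
proof -
  have "w (t x) < w (t y)" if "x < y" "t y < t x" "w x < w y" for x y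
    by (cases rule: t_cases[of x]; cases rule: t_cases[of y]) (use that ij in auto)
  then show ?thesis by (auto simp: G_def up_def down_def)
qed

private lemma orbit_card_down:
  "orbit_card n down = orbit_card n up + orbit_card n (down - G ` up)"
proof -
  have "down \<inter> G ` up = G ` up" using G_up by blast
  moreover have "orbit_card n (G ` up) = orbit_card n up"
    by (rule orbit_card_image[OF n shift_up G_inj G_shift])
  ultimately show ?thesis using orbit_card_Int_Diff[OF finite_down, of "G ` up"] by simp
qed

private lemma t_ij: "t i = j" "t j = i"
  using affine_transp_left[of n i j 0] affine_transp_right[OF nd, of 0] by (simp_all add: t_def)

private lemma rep_in_excess:
  "shift_pair n (- (i div int n)) (i, j) \<in> orbit_reps n (down - G ` up)"
proof -
  have "(i, j) \<in> down" "(i, j) \<notin> up" using ij by (simp_all add: down_def up_def t_ij)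
  moreover have "(i, j) \<notin> G ` up"
  proof
    assume "(i, j) \<in> G ` up"
    then have "G (i, j) \<in> up" by auto
    then show False using \<open>(i, j) \<notin> up\<close> by (simp add: G_def t_ij)
  qed
  ultimately have "(i, j) \<in> down - G ` up" by blast
  moreover have "shift_invariant n (down - G ` up)"
    by (intro shift_invariant_Diff shift_down shift_invariant_image shift_up G_shift)
  ultimately show ?thesis
    using shift_rep_bounds[OF n, of "(i, j)"] by (simp add: orbit_reps_def shift_invariant_def)
qed

text \<open>The net loss is the number of orbits of \<open>down\<close> missed by \<open>G\<close>,
  and the orbit of \<open>(i, j)\<close> is one of them.\<close>

lemma inv_num_transp_less: "inv_num n (w \<circ> affine_transp n i j) < inv_num n w"
proof -
  have "finite (orbit_reps n (down - G ` up))"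
    by (rule finite_subset[OF _ finite_down]) (auto simp: orbit_reps_def)
  then have "orbit_card n (down - G ` up) > 0"
    using rep_in_excess unfolding orbit_card_def card_gt_0_iff by blast
  then show ?thesis using inv_num_comp orbit_card_down by (simp add: t_def)
qed

lemma inv_num_transp_covering:
  assumes "covering n w i j"
  shows "inv_num n w = Suc (inv_num n (w \<circ> affine_transp n i j))"
proof -
  have short: "j - i < int n \<or> w i - w j < int n"
    and hollow: "\<And>k. i < k \<Longrightarrow> k < j \<Longrightarrow> w k \<le> w j \<or> w i \<le> w k"
    using assms unfolding covering_def by (auto simp: not_less)
  \<comment> \<open>These are the pairs of \<open>down\<close> missed by \<open>G\<close>. If
    \<open>x\<close> and \<open>y\<close> are moved inside different translates of
    \<open>(i, j)\<close>, \<open>short\<close> is violated; if only one of them is moved, a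
    translate of the other violates \<open>hollow\<close>; the remaining cases contradict the
    order.\<close>
  have excess: "\<exists>k. x = i + k * int n \<and> y = j + k * int n"
    if xy: "x < y" "t y < t x" "w y < w x" and notup: "w (t x) \<le> w (t y)" for x y
  proof (cases rule: t_cases[of x])
    case x: (left k)
    show ?thesis
    proof (cases rule: t_cases[of y])
      case (left l)
      then show ?thesis using x xy by simp
    next
      case y: (right l)
      show ?thesis
      proof (cases "l = k")
        case False
        then have "l - k \<ge> 1 \<or> l - k \<le> - 1" by linarith
        then have "(l - k) * int n \<ge> int n \<or> (l - k) * int n \<le> - int n"
          using mult_right_mono[of 1 "l - k" "int n"] mult_right_mono[of "l - k" "- 1" "int n"]
          by auto
        then show ?thesis using x y xy notup short by (auto simp: algebra_simps)
      qed (use x y in auto)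
    next
      case y: fixed
      define z where "z = y - k * int n"
      have "w y = w z + k * int n" using periodic_bij_shift[OF w, of z k] by (simp add: z_def)
      then show ?thesis using x y xy notup hollow[of z] w_eq_iff[of z i] w_eq_iff[of z j]
        by (auto simp: z_def)
    qed
  next
    case x: (right k)
    show ?thesis by (cases rule: t_cases[of y]) (use x xy ij in auto)
  next
    case x: fixed
    show ?thesis
    proof (cases rule: t_cases[of y])
      case y: (right l)
      define z where "z = x - l * int n"
      have "w x = w z + l * int n" using periodic_bij_shift[OF w, of z l] by (simp add: z_def)
      then show ?thesis using x y xy notup hollow[of z] w_eq_iff[of z i] w_eq_iff[of z j]
        by (auto simp: z_def)
    qed (use x xy ij in auto)
  qed
  have "orbit_reps n (down - G ` up) = {shift_pair n (- (i div int n)) (i, j)}" (is "_ = {?p}")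
  proof
    show "orbit_reps n (down - G ` up) \<subseteq> {?p}"
    proof
      fix p assume p: "p \<in> orbit_reps n (down - G ` up)"
      obtain x y where xy: "p = (x, y)" by (cases p)
      have d: "x < y" "t y < t x" "w y < w x" using p xy by (auto simp: orbit_reps_def down_def)
      have "w (t x) \<le> w (t y)"
      proof (rule ccontr)
        assume "\<not> w (t x) \<le> w (t y)"
        then have "G p \<in> up" using d by (simp add: xy G_def up_def)
        then have "p \<in> G ` up" by (metis G_involution imageI)
        then show False using p by (simp add: orbit_reps_def)
      qed
      then obtain k where k: "x = i + k * int n" "y = j + k * int n" using excess d by blast
      then have "p = shift_pair n (k + i div int n) ?p"
        unfolding shift_pair_add by (simp add: xy shift_pair_def)
      moreover from this have "k + i div int n = 0"
        using p shift_rep_bounds[OF n, of "(i, j)"]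
        by (intro shift_rep_unique[of ?p n]) (auto simp: orbit_reps_def)
      ultimately show "p \<in> {?p}" by simp
    qed
  qed (use rep_in_excess in simp)
  then have "orbit_card n (down - G ` up) = 1" by (simp add: orbit_card_def)
  then show ?thesis using inv_num_comp orbit_card_down by (simp add: t_def)
qed

end

section \<open>Length and Bruhat order\<close>

lemma covering_adjacent:
  "n \<ge> 2 \<Longrightarrow> w (i + 1) < w i \<Longrightarrow> covering n w i (i + 1)"
  by (auto simp: covering_def)

lemma inv_num_simple:
  assumes n: "n \<ge> 2" and w: "periodic_bij n w"
  shows "inv_num n w = Suc (inv_num n (w \<circ> simple_refl n i)) \<or>
    inv_num n (w \<circ> simple_refl n i) = Suc (inv_num n w)"
proof -
  let ?s = "simple_refl n i"
  have desc: "inv_num n v = Suc (inv_num n (v \<circ> ?s))"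
    if "periodic_bij n v" "v (int i + 1) < v (int i)" for v
    using inv_num_transp_covering[OF _ that(1) _ that(2)] covering_adjacent[of n v] that n
    by (simp add: simple_refl_eq)
  have nd: "\<not> int n dvd int i + 1 - int i" using not_dvd_one n by simp
  have s: "periodic_bij n ?s"
    using simple_refl_in_affine_sym n affine_sym_periodic by blast
  have "w (int i) \<noteq> w (int i + 1)" using periodic_bij_inj[OF w] by simp
  then consider "w (int i + 1) < w (int i)" | "w (int i) < w (int i + 1)" by linarith
  then show ?thesis
  proof cases
    case 2
    have "(w \<circ> ?s) (int i + 1) < (w \<circ> ?s) (int i)"
      using 2 affine_transp_left[of n "int i" "int i + 1" 0] affine_transp_right[OF nd, of 0]
      by (simp add: simple_refl_eq)
    moreover have "(w \<circ> ?s) \<circ> ?s = w"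
      using affine_transp_involution[OF nd] by (simp add: fun_eq_iff simple_refl_eq)
    ultimately show ?thesis using desc[of "w \<circ> ?s"] periodic_bij_comp[OF w s] by simp
  qed (use desc w in simp)
qed

section \<open>Words in the generators and the length formula\<close>

lemma word_prod_Nil: "word_prod n [] = id"
  by (simp add: word_prod_def)

lemma word_prod_snoc: "word_prod n (is @ [i]) = word_prod n is \<circ> simple_refl n i"
  by (induction "is") (simp_all add: word_prod_def o_assoc)

lemma id_in_affine_sym: "id \<in> affine_sym n"
  by (simp add: affine_sym_iff periodic_bij_def)

lemma inv_num_id: "inv_num n id = 0"
proof -
  have "inversions id = {}" by (auto simp: inversions_def)
  then show ?thesis by (simp add: inv_num_def orbit_card_def orbit_reps_def)
qed

lemma word_prod_in_affine_sym:
  assumes "n \<ge> 2"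
  shows "word_prod n is \<in> affine_sym n"
proof (induction "is" rule: rev_induct)
  case Nil
  then show ?case unfolding word_prod_Nil by (rule id_in_affine_sym)
next
  case (snoc i "is")
  then have "word_prod n is \<circ> simple_refl n i \<in> affine_sym n"
    using affine_sym_comp simple_refl_in_affine_sym assms by simp
  then show ?case by (simp only: word_prod_snoc)
qed

lemma inv_num_word_prod:
  assumes "n \<ge> 2"
  shows "inv_num n (word_prod n is) \<le> length is"
proof (induction "is" rule: rev_induct)
  case Nil
  then show ?case unfolding word_prod_Nil inv_num_id by simp
next
  case (snoc i "is")
  then have "inv_num n (word_prod n is \<circ> simple_refl n i) \<le> length (is @ [i])"
    using inv_num_simple[OF assms affine_sym_periodic[OF word_prod_in_affine_sym[OF assms]], of "is" i]
    by auto
  then show ?case by (simp only: word_prod_snoc)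
qed

text \<open>An increasing bijection of the integers is a translation, and the normalisation of the
  sum allows only the trivial one.\<close>

lemma affine_sym_ascending_eq_id:
  assumes n: "n > 0" and w: "w \<in> affine_sym n" and asc: "\<And>i. w i < w (i + 1)"
  shows "w = id"
proof -
  have bij: "bij w" using w affine_sym_periodic by (auto simp: periodic_bij_def)
  have mono: "w i < w j" if "i < j" for i j
    using that by (induction rule: int_gr_induct) (use asc less_trans in blast)+
  have step: "w (i + 1) = w i + 1" for i
  proof -
    obtain k where k: "w k = w i + 1" using bij by (metis bij_pointE)
    have "k > i" using mono[of k i] k by (cases "k < i"; cases "k = i") auto
    moreover have "\<not> k > i + 1" using mono[of "i + 1" k] asc[of i] k by auto
    ultimately have "k = i + 1" by linarith
    then show ?thesis using k by simp
  qed
  have w_eq: "w i = i + w 0" for i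
  proof (induction i rule: int_induct[of _ 0])
    case (step1 i)
    then show ?case using step[of i] by simp
  next
    case (step2 i)
    then show ?case using step[of "i - 1"] by simp
  qed simp
  have "(\<Sum>i = 1..int n. w i - i) = int n * w 0" by (subst w_eq) simp
  then have "w 0 = 0" using w n by (simp add: affine_sym_iff)
  then have "w i = i" for i using w_eq[of i] by simp
  then show ?thesis by (simp add: fun_eq_iff)
qed

text \<open>Any element other than the identity has an adjacent descent; this is a covering, so the
  corresponding generator removes exactly one inversion.\<close>

lemma reduced_word_exists:
  assumes n: "n \<ge> 2"
  shows "w \<in> affine_sym n \<Longrightarrow>
    \<exists>is. length is = inv_num n w \<and> set is \<subseteq> {..<n} \<and> word_prod n is = w"
proof (induction "inv_num n w" arbitrary: w rule: less_induct)
  case less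
  show ?case
  proof (cases "\<forall>i. w i < w (i + 1)")
    case True
    then have "w = id" using affine_sym_ascending_eq_id[of n w] n less.prems by simp
    then show ?thesis by (intro exI[of _ "[]"]) (simp add: inv_num_id word_prod_def)
  next
    case False
    then obtain i where i: "\<not> w i < w (i + 1)" by blast
    have w: "periodic_bij n w" using less.prems affine_sym_periodic by blast
    have desc: "w (i + 1) < w i"
      using i periodic_bij_inj[OF w, of i "i + 1"] by linarith
    define k where "k = nat (i mod int n)"
    have k: "k < n" using n by (simp add: k_def nat_less_iff)
    have s: "affine_transp n i (i + 1) = simple_refl n k"
      using adjacent_affine_transp n by (simp add: k_def)
    define v where "v = w \<circ> simple_refl n k"
    have v: "inv_num n w = Suc (inv_num n v)"
      unfolding v_def s[symmetric]
      using inv_num_transp_covering[OF _ w _ desc covering_adjacent] n desc by simp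
    have "v \<in> affine_sym n"
      unfolding v_def using affine_sym_comp simple_refl_in_affine_sym n less.prems by simp
    then obtain ks where ks: "length ks = inv_num n v" "set ks \<subseteq> {..<n}" "word_prod n ks = v"
      using less.hyps[of v] v by auto
    have "\<not> int n dvd i + 1 - i" using not_dvd_one n by simp
    then have "v \<circ> simple_refl n k = w"
      unfolding v_def s[symmetric] by (simp add: fun_eq_iff affine_transp_involution)
    then show ?thesis
      using ks v k by (intro exI[of _ "ks @ [k]"]) (simp add: word_prod_snoc)
  qed
qed

lemma coxeter_length_eq_inv_num:
  assumes "n \<ge> 2" "w \<in> affine_sym n"
  shows "coxeter_length n w = inv_num n w"
  unfolding coxeter_length_def
proof (rule Least_equality)
  show "\<exists>is. length is = inv_num n w \<and> set is \<subseteq> {..<n} \<and> word_prod n is = w"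
    using reduced_word_exists assms by blast
qed (use inv_num_word_prod[OF assms(1)] in blast)

lemma finite_bounded_length:
  assumes n: "n \<ge> 2"
  shows "finite {v \<in> affine_sym n. coxeter_length n v \<le> L}"
proof (rule finite_subset)
  show "{v \<in> affine_sym n. coxeter_length n v \<le> L}
      \<subseteq> word_prod n ` {is. set is \<subseteq> {..<n} \<and> length is \<le> L}"
  proof
    fix v assume v: "v \<in> {v \<in> affine_sym n. coxeter_length n v \<le> L}"
    then obtain ks where "length ks = inv_num n v" "set ks \<subseteq> {..<n}" "word_prod n ks = v"
      using reduced_word_exists[OF n] by blast
    then show "v \<in> word_prod n ` {is. set is \<subseteq> {..<n} \<and> length is \<le> L}"
      using v coxeter_length_eq_inv_num[OF n] by auto
  qed
  show "finite (word_prod n ` {is. set is \<subseteq> {..<n} \<and> length is \<le> L})"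
    using finite_lists_length_le[of "{..<n}" L] by simp
qed

section \<open>Bruhat intervals, coatoms and elements of length one\<close>

lemma bruhat_le_length:
  "bruhat_le n v w \<Longrightarrow> coxeter_length n v \<le> coxeter_length n w"
  unfolding bruhat_le_def by (induction rule: rtranclp_induct) (auto simp: bruhat_step_def)

lemma finite_bruhat_interval:
  assumes "n \<ge> 2"
  shows "finite {v \<in> affine_sym n. bruhat_le n v w}"
  by (rule finite_subset[OF _ finite_bounded_length[OF assms, of "coxeter_length n w"]])
    (auto dest: bruhat_le_length)

lemma covering_coatom:
  assumes n: "n \<ge> 3" and w: "w \<in> affine_sym n" and c: "covering n w i j"
  shows "w \<circ> affine_transp n i j \<in> affine_sym n"
    "bruhat_le n (w \<circ> affine_transp n i j) w"
    "coxeter_length n w = Suc (coxeter_length n (w \<circ> affine_transp n i j))"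
proof -
  let ?t = "affine_transp n i j" and ?v = "w \<circ> affine_transp n i j"
  note p = affine_sym_periodic[OF w]
  have ij: "i < j" "w j < w i" using c by (auto simp: covering_def)
  note nd = inversion_not_dvd[OF p ij]
  show v: "?v \<in> affine_sym n" using affine_sym_comp affine_transp_in_affine_sym nd n w by simp
  show len: "coxeter_length n w = Suc (coxeter_length n ?v)"
    using inv_num_transp_covering[OF _ p ij c] n coxeter_length_eq_inv_num v w by simp
  have "w = ?v \<circ> ?t"
    by (simp add: fun_eq_iff affine_transp_involution[OF nd])
  then have "bruhat_step n ?v w"
    unfolding bruhat_step_def using v len affine_transp_in_reflections[OF n ij(1) nd] by auto
  then show "bruhat_le n ?v w" unfolding bruhat_le_def by blast
qed

text \<open>In an affine permutation this says that the generator \<open>s\<^sub>k\<close> (index modulo \<open>n\<close>) occurs in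
  its reduced words.\<close>

definition crossed :: "(int \<Rightarrow> int) \<Rightarrow> int \<Rightarrow> bool" where
  "crossed w k \<longleftrightarrow> (\<exists>i j. i \<le> k \<and> k < j \<and> w j < w i)"

text \<open>The reflection exchanges inverted positions of \<open>v\<close>. If no inversion of
  \<open>v\<close> straddled \<open>k\<close>, it would therefore keep every position on its side of
  \<open>k\<close>, and an inversion of \<open>u\<close> across \<open>k\<close> would be carried to
  one of \<open>v\<close>.\<close>

lemma crossed_bruhat_step:
  assumes n: "n \<ge> 2" and step: "bruhat_step n u v" and v: "v \<in> affine_sym n"
    and cross: "crossed u k"
  shows "crossed v k"
proof (rule ccontr)
  assume nc: "\<not> crossed v k"
  have u: "u \<in> affine_sym n" using step by (simp add: bruhat_step_def)
  note pv = affine_sym_periodic[OF v] and pu = affine_sym_periodic[OF u]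
  obtain t where t: "t \<in> reflections n" "v = u \<circ> t" "coxeter_length n u < coxeter_length n v"
    using step by (auto simp: bruhat_step_def)
  obtain i j where ij: "i < j" "\<not> int n dvd j - i" "t = affine_transp n i j"
    using reflectionE[OF n t(1)] .
  have u_eq: "u = v \<circ> t" using t ij by (simp add: fun_eq_iff affine_transp_involution)
  have less: "inv_num n u < inv_num n v"
    using t u v coxeter_length_eq_inv_num[OF n] by simp
  \<comment> \<open>Otherwise \<open>(i, j)\<close> is an inversion of \<open>u\<close>, and
    \<open>v\<close> has fewer inversions than \<open>u\<close>.\<close>
  have inv: "v j < v i"
  proof (rule ccontr)
    assume "\<not> v j < v i"
    moreover have "u i = v j" "u j = v i"
      using affine_transp_left[of n i j 0] affine_transp_right[OF ij(2), of 0]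
      by (simp_all add: u_eq ij(3))
    moreover have "v i \<noteq> v j" using periodic_bij_inj[OF pv] ij by simp
    ultimately have "u j < u i" by simp
    then have "inv_num n v < inv_num n u"
      using inv_num_transp_less[OF _ pu ij(1)] n t ij(3) by simp
    then show False using less by simp
  qed
  have side: "t x \<le> k \<longleftrightarrow> x \<le> k" for x
  proof -
    have "i + l * int n \<le> k \<longleftrightarrow> j + l * int n \<le> k" for l
    proof (rule ccontr)
      assume "\<not> ?thesis"
      then have "i + l * int n \<le> k" "k < j + l * int n" using ij(1) by auto
      moreover have "v (j + l * int n) < v (i + l * int n)"
        using inv periodic_bij_shift[OF pv] by simp
      ultimately show False using nc by (auto simp: crossed_def)
    qed
    then show ?thesis
      using affine_transp_cases[OF ij(2), of x] unfolding ij(3) by metis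
  qed
  obtain x y where "x \<le> k" "k < y" "u y < u x" using cross by (auto simp: crossed_def)
  then have "t x \<le> k" "k < t y" "v (t y) < v (t x)"
    using side[of x] side[of y] by (auto simp: u_eq)
  then show False using nc by (auto simp: crossed_def)
qed

lemma crossed_bruhat_le:
  assumes n: "n \<ge> 2" and le: "bruhat_le n u w" and w: "w \<in> affine_sym n" and cross: "crossed u k"
  shows "crossed w k"
  using le[unfolded bruhat_le_def] cross
proof (induction rule: converse_rtranclp_induct)
  case (step u v)
  have "v \<in> affine_sym n"
    using step.hyps(2) w by (cases rule: converse_rtranclpE) (auto simp: bruhat_step_def)
  then show ?case using crossed_bruhat_step[OF n step.hyps(1)] step by blast
qed

text \<open>An element of length one is a generator; it crosses its own index, and crossing passes
  up to \<open>w\<close>.\<close>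

lemma length_one_elements:
  assumes n: "n \<ge> 2" and w: "w \<in> affine_sym n"
  shows "{v \<in> affine_sym n. bruhat_le n v w \<and> coxeter_length n v = 1}
    \<subseteq> simple_refl n ` {k \<in> {..<n}. crossed w (int k)}"
proof
  fix v assume v: "v \<in> {v \<in> affine_sym n. bruhat_le n v w \<and> coxeter_length n v = 1}"
  then obtain ks where ks: "length ks = inv_num n v" "set ks \<subseteq> {..<n}" "word_prod n ks = v"
    using reduced_word_exists[OF n] by blast
  then have "length ks = 1" using v coxeter_length_eq_inv_num[OF n, of v] by simp
  then obtain k where "ks = [k]" by (auto simp: length_Suc_conv)
  then have k: "k < n" "v = simple_refl n k" using ks by (auto simp: word_prod_def)
  have nd: "\<not> int n dvd int k + 1 - int k" using not_dvd_one n by simp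
  have "v (int k) = int k + 1" "v (int k + 1) = int k"
    using affine_transp_left[of n "int k" "int k + 1" 0] affine_transp_right[OF nd, of 0]
    by (simp_all add: k(2) simple_refl_eq)
  then have "crossed v (int k)"
    unfolding crossed_def by (intro exI[of _ "int k"] exI[of _ "int k + 1"]) auto
  then have "crossed w (int k)" using crossed_bruhat_le[OF n _ w] v by blast
  then show "v \<in> simple_refl n ` {k \<in> {..<n}. crossed w (int k)}" using k by blast
qed

section \<open>Palindromicity\<close>

text \<open>The coefficient of \<open>q\<close> counts the elements of length one in
  \<open>P(q)\<close> and the coatoms in \<open>q^l(w) P(1/q)\<close>.\<close>

lemma palindromic_card_eq:
  assumes n: "n \<ge> 2" and pal: "palindromic n w"
  shows "card {v \<in> affine_sym n. bruhat_le n v w \<and> coxeter_length n v = 1}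
    = card {v \<in> affine_sym n. bruhat_le n v w \<and> coxeter_length n w = Suc (coxeter_length n v)}"
proof -
  define I where "I = {v \<in> affine_sym n. bruhat_le n v w}"
  define l where "l = coxeter_length n"
  \<comment> \<open>The polynomial \<open>q^l(w) P(1/q)\<close>; agreement at the infinitely many
    nonzero \<open>q\<close> identifies it with \<open>poincare_poly n w\<close>.\<close>
  define Q where "Q = (\<Sum>v\<in>I. monom (1 :: rat) (l w - l v))"
  have fin: "finite I" using finite_bruhat_interval[OF n] by (simp add: I_def)
  have le: "l v \<le> l w" if "v \<in> I" for v
    using that bruhat_le_length by (auto simp: I_def l_def)
  have P: "poincare_poly n w = (\<Sum>v\<in>I. monom 1 (l v))"
    by (simp add: poincare_poly_def I_def l_def)
  have "poly (poincare_poly n w) q = poly Q q" if "q \<noteq> 0" for q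
  proof -
    have "poly (poincare_poly n w) q = q ^ l w * poly (poincare_poly n w) (inverse q)"
      using pal that unfolding palindromic_def l_def by blast
    also have "\<dots> = (\<Sum>v\<in>I. q ^ l w * inverse q ^ l v)"
      by (simp add: P poly_sum poly_monom sum_distrib_left)
    also have "\<dots> = (\<Sum>v\<in>I. q ^ (l w - l v))"
      by (intro sum.cong) (use le that in \<open>auto simp: power_diff power_inverse divide_inverse\<close>)
    finally show ?thesis by (simp add: Q_def poly_sum poly_monom)
  qed
  then have "- {0} \<subseteq> {q. poly (poincare_poly n w - Q) q = 0}" by auto
  moreover have "infinite (- {0 :: rat})"
    using infinite_UNIV_char_0 by (simp add: Compl_eq_Diff_UNIV)
  ultimately have "poincare_poly n w - Q = 0"
    using poly_roots_finite infinite_super by blast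
  then have "coeff (poincare_poly n w) 1 = coeff Q 1" by simp
  moreover have "coeff (poincare_poly n w) 1 = of_nat (card {v \<in> I. l v = 1})"
    using fin by (simp add: P coeff_sum sum.If_cases Int_def)
  moreover have "coeff Q 1 = of_nat (card {v \<in> I. l w - l v = 1})"
    using fin by (simp add: Q_def coeff_sum sum.If_cases Int_def)
  moreover have "{v \<in> I. l w - l v = 1} = {v \<in> I. l w = Suc (l v)}" by auto
  ultimately show ?thesis by (simp add: I_def l_def conj_assoc)
qed

section \<open>Roots of coatoms\<close>

text \<open>The ambient space of the roots. Coordinates are indexed by all integers, and those of
  \<open>root_vec\<close> are periodic, which avoids an index type of residue classes.\<close>

interpretation rat_fun: vector_space "\<lambda>(c :: rat) (f :: int \<Rightarrow> rat) r. c * f r"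
  by unfold_locales (auto simp: fun_eq_iff algebra_simps)

text \<open>The root \<open>\<alpha>\<^sub>i + \<dots> + \<alpha>\<^bsub>j-1\<^esub>\<close> (indices modulo \<open>n\<close>) of the transposition of \<open>i\<close> and \<open>j\<close>.
  Its coordinate at \<open>\<alpha>\<^sub>r\<close> is the number of \<open>k\<close> with \<open>i \<le> k < j\<close> in the residue class of \<open>r\<close>,
  written as a difference so that additivity is immediate.\<close>

definition root_vec :: "nat \<Rightarrow> int \<Rightarrow> int \<Rightarrow> int \<Rightarrow> rat" where
  "root_vec n i j r = of_int ((j - 1 - r) div int n) - of_int ((i - 1 - r) div int n)"

lemma root_vec_add: "root_vec n i k + root_vec n k j = root_vec n i j"
  by (simp add: root_vec_def fun_eq_iff)

lemma root_vec_shift_right: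
  assumes "n > 0"
  shows "root_vec n i (j + m * int n) = (\<lambda>r. root_vec n i j r + of_int m)"
proof
  fix r
  have "(j + m * int n - 1 - r) div int n = (j - 1 - r) div int n + m"
    using assms div_mult_self1[of "int n" "j - 1 - r" m] by (simp add: algebra_simps)
  then show "root_vec n i (j + m * int n) r = root_vec n i j r + of_int m"
    by (simp add: root_vec_def)
qed

lemma root_vec_shift:
  assumes "n > 0"
  shows "root_vec n (i + m * int n) (j + m * int n) = root_vec n i j"
proof
  fix r
  have "(x + m * int n - 1 - r) div int n = (x - 1 - r) div int n + m" for x
    using assms div_mult_self1[of "int n" "x - 1 - r" m] by (simp add: algebra_simps)
  then show "root_vec n (i + m * int n) (j + m * int n) r = root_vec n i j r"
    by (simp add: root_vec_def)
qed

lemma div_diff_pred: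
  fixes x N :: int
  assumes "N > 0"
  shows "x div N - (x - 1) div N = (if N dvd x then 1 else 0)"
proof (cases "N dvd x")
  case True
  then obtain q where q: "x = N * q" by (auto simp: dvd_def)
  have "(x - 1) div N = q - 1"
    by (rule int_div_pos_eq[of _ _ _ "N - 1"]) (use assms in \<open>auto simp: q algebra_simps\<close>)
  then show ?thesis using assms by (simp add: q)
next
  case False
  have "x mod N > 0" using False assms by (simp add: dvd_eq_mod_eq_0 order_less_le)
  then have "(x - 1) div N = x div N"
    using assms pos_mod_bound[of N x] mult_div_mod_eq[of N x]
    by (intro int_div_pos_eq[of _ _ _ "x mod N - 1"]) linarith+
  then show ?thesis using False by simp
qed

lemma root_vec_simple:
  assumes "n > 0"
  shows "root_vec n k (k + 1) r = (if int n dvd k - r then 1 else 0)"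
proof -
  have "k + 1 - 1 - r = k - r" "k - 1 - r = (k - r) - 1" by simp_all
  then have "root_vec n k (k + 1) r = of_int ((k - r) div int n - (k - r - 1) div int n)"
    by (simp only: root_vec_def of_int_diff)
  also have "\<dots> = (if int n dvd k - r then 1 else 0)"
    using div_diff_pred[of "int n" "k - r"] assms by simp
  finally show ?thesis .
qed

lemma sum_fun_apply: "(\<Sum>x\<in>A. f x) r = (\<Sum>x\<in>A. f x r)"
  for f :: "'a \<Rightarrow> 'b \<Rightarrow> 'c :: comm_monoid_add"
  by (induction A rule: infinite_finite_induct) auto

text \<open>Evaluation at \<open>int l\<close> is the coordinate dual to the simple root of
  \<open>l\<close>, because indices below \<open>n\<close> are pairwise incongruent.\<close>

lemma independent_simple_roots:
  assumes K: "K \<subseteq> {..<n}"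
  shows "rat_fun.independent ((\<lambda>k. root_vec n (int k) (int k + 1)) ` K)"
    and "inj_on (\<lambda>k. root_vec n (int k) (int k + 1)) K"
proof -
  let ?e = "\<lambda>k. root_vec n (int k) (int k + 1)"
  have e: "?e k (int l) = (if k = l then 1 else 0)" if "k \<in> K" "l \<in> K" for k l
  proof -
    have "k < n" "l < n" using that K by auto
    have "int n dvd int k - int l \<longleftrightarrow> k = l"
    proof
      assume "int n dvd int k - int l"
      then have "int n dvd \<bar>int k - int l\<bar>" by simp
      moreover have "\<bar>int k - int l\<bar> < int n" using \<open>k < n\<close> \<open>l < n\<close> by linarith
      ultimately show "k = l" using zdvd_imp_le[of "int n" "\<bar>int k - int l\<bar>"] by linarith
    qed simp
    then show ?thesis using root_vec_simple[of n "int k" "int l"] \<open>k < n\<close> by simp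
  qed
  show inj: "inj_on ?e K"
  proof (rule inj_onI)
    fix k l assume kl: "k \<in> K" "l \<in> K" "?e k = ?e l"
    then have "?e k (int l) = ?e l (int l)" by simp
    then show "k = l" using e kl(1,2) by (auto split: if_splits)
  qed
  have fin: "finite K" using K finite_subset by blast
  show "rat_fun.independent (?e ` K)"
  proof (rule rat_fun.independent_if_scalars_zero)
    fix f :: "(int \<Rightarrow> rat) \<Rightarrow> rat" and x
    assume zero: "(\<Sum>x\<in>?e ` K. (\<lambda>r. f x * x r)) = 0" and "x \<in> ?e ` K"
    then obtain l where l: "l \<in> K" "x = ?e l" by blast
    have "0 = (\<Sum>x\<in>?e ` K. f x * x (int l))"
      using fun_cong[OF zero, of "int l"] by (simp add: sum_fun_apply)
    also have "\<dots> = (\<Sum>k\<in>K. f (?e k) * ?e k (int l))"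
      by (simp add: sum.reindex[OF inj])
    also have "\<dots> = (\<Sum>k\<in>K. if k = l then f (?e l) else 0)"
      by (intro sum.cong) (use e l in auto)
    also have "\<dots> = f x" using fin l by simp
    finally show "f x = 0" by simp
  qed (use fin in simp)
qed

section \<open>The span of the roots of coverings\<close>

context
  fixes n :: nat and w :: "int \<Rightarrow> int"
  assumes n: "n > 0" and w: "periodic_bij n w"
begin

definition short_inversion :: "int \<Rightarrow> int \<Rightarrow> bool" where
  "short_inversion i j \<longleftrightarrow> i < j \<and> w j < w i \<and> (j - i < int n \<or> w i - w j < int n)"

text \<open>\<open>P\<close> is used to bound the displacement of the left end. The displacement is
  invariant under translation and drops on passing to a position further right with a smaller value,
  so it separates coverings starting in one class from those arising later in a splitting.\<close>

definition covering_roots :: "(int \<Rightarrow> bool) \<Rightarrow> (int \<Rightarrow> rat) set" where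
  "covering_roots P = {root_vec n i j |i j. covering n w i j \<and> P (w i - i)}"

lemma covering_roots_mono:
  "(\<And>x. P x \<Longrightarrow> Q x) \<Longrightarrow> rat_fun.span (covering_roots P) \<subseteq> rat_fun.span (covering_roots Q)"
  by (intro rat_fun.span_mono) (auto simp: covering_roots_def)

text \<open>A position \<open>k\<close> that obstructs the covering splits the inversion into two
  closer ones, both again short, and \<open>w k - k < w i - i\<close>.\<close>

lemma short_inversion_in_span:
  "short_inversion i j \<Longrightarrow> root_vec n i j \<in> rat_fun.span (covering_roots (\<lambda>x. x \<le> w i - i))"
proof (induction "nat (j - i)" arbitrary: i j rule: less_induct)
  case less
  show ?case
  proof (cases "covering n w i j")
    case True
    then show ?thesis by (intro rat_fun.span_base) (auto simp: covering_roots_def)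
  next
    case False
    then obtain k where k: "i < k" "k < j" "w j < w k" "w k < w i"
      using less.prems by (auto simp: covering_def short_inversion_def)
    have "short_inversion i k" "short_inversion k j"
      using less.prems k by (auto simp: short_inversion_def)
    then have "root_vec n i k \<in> rat_fun.span (covering_roots (\<lambda>x. x \<le> w i - i))"
      "root_vec n k j \<in> rat_fun.span (covering_roots (\<lambda>x. x \<le> w k - k))"
      using less.hyps k by auto
    moreover have "rat_fun.span (covering_roots (\<lambda>x. x \<le> w k - k))
        \<subseteq> rat_fun.span (covering_roots (\<lambda>x. x \<le> w i - i))"
      using k by (intro covering_roots_mono) auto
    ultimately have "root_vec n i k + root_vec n k j \<in> rat_fun.span (covering_roots (\<lambda>x. x \<le> w i - i))"
      by (intro rat_fun.span_add) auto
    then show ?thesis by (simp add: root_vec_add)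
  qed
qed

text \<open>A long inversion lies strictly between the two extreme inversions obtained by translating
  its right end, and its root is a convex combination of theirs.\<close>

lemma long_inversion:
  assumes ij: "i < j" "w j < w i" and long: "\<not> short_inversion i j"
  obtains j0 j1 \<alpha> \<beta> where "short_inversion i j0" "short_inversion i j1" "j0 < j" "w j < w j1"
    "\<alpha> > 0" "\<beta> > 0" "\<alpha> + \<beta> = 1"
    "root_vec n i j = (\<lambda>r. \<alpha> * root_vec n i j0 r) + (\<lambda>r. \<beta> * root_vec n i j1 r)"
proof -
  have gaps: "j - i \<ge> int n" "w i - w j \<ge> int n"
    using assms by (auto simp: short_inversion_def)
  have nd: "\<not> int n dvd j - i" using inversion_not_dvd[OF w ij] .
  have nd': "\<not> int n dvd w i - w j"
    using nd periodic_bij_dvd[OF w, of i j] dvd_diff_commute[of "int n" i j] by blast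
  have mod_pos: "x mod int n > 0" if "\<not> int n dvd x" for x
    using that n pos_mod_sign[of "int n" x] unfolding dvd_eq_mod_eq_0 by linarith
  note mods = mod_pos[OF nd] mod_pos[OF nd']
  have mods_less: "(j - i) mod int n < int n" "(w i - w j) mod int n < int n"
    using n by simp_all
  \<comment> \<open>\<open>m\<close> is the largest number of periods by which \<open>j\<close> can
    move left and stay to the right of \<open>i\<close>; \<open>l\<close> is the largest number by
    which it can move right with its value staying below \<open>w i\<close>.\<close>
  define m where "m = (j - i) div int n"
  define l where "l = (w i - w j) div int n"
  have pos: "m \<ge> 1" "l \<ge> 1"
    using gaps n zdiv_mono1[of "int n" "j - i" "int n"] zdiv_mono1[of "int n" "w i - w j" "int n"]
    by (simp_all add: m_def l_def)
  have eqs: "j - i = m * int n + (j - i) mod int n"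
    "w i - w j = l * int n + (w i - w j) mod int n"
    unfolding m_def l_def by simp_all
  have mn: "m * int n \<ge> int n" "l * int n \<ge> int n"
    using pos mult_right_mono[of 1 m "int n"] mult_right_mono[of 1 l "int n"] by simp_all
  have ml: "rat_of_int m + rat_of_int l > 0" using pos by simp
  \<comment> \<open>The two translations add the constants \<open>-m\<close> and \<open>l\<close> to
    every coordinate, and the weights are chosen such that these cancel.\<close>
  have comb: "l / (m + l) * (x - m) + m / (m + l) * (x + l) = x" if "m + l \<noteq> 0" for l m x :: rat
  proof -
    have "l / (m + l) * (x - m) + m / (m + l) * (x + l) = (l * (x - m) + m * (x + l)) / (m + l)"
      by (simp add: add_divide_distrib)
    also have "l * (x - m) + m * (x + l) = (m + l) * x" by (simp add: algebra_simps)
    finally show ?thesis using that by simp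
  qed
  have w_vals: "w (j + (- m) * int n) = w j + (- m) * int n" "w (j + l * int n) = w j + l * int n"
    using periodic_bij_shift[OF w] by blast+
  show thesis
  proof (rule that)
    show "short_inversion i (j + (- m) * int n)"
      using eqs(1) mods(1) mods_less(1) mn n ij unfolding short_inversion_def w_vals
      by (intro conjI disjI1; linarith)
    show "short_inversion i (j + l * int n)"
      using eqs(2) mods(2) mods_less(2) mn n ij unfolding short_inversion_def w_vals
      by (intro conjI disjI2; linarith)
    show "j + (- m) * int n < j" "w j < w (j + l * int n)"
      using mn n unfolding w_vals by auto
    show "rat_of_int l / (of_int m + of_int l) > 0" "rat_of_int m / (of_int m + of_int l) > 0"
      using pos ml by simp_all
    show "rat_of_int l / (of_int m + of_int l) + rat_of_int m / (of_int m + of_int l) = 1"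
      using ml by (simp add: add_divide_distrib[symmetric] add.commute)
    show "root_vec n i j
        = (\<lambda>r. rat_of_int l / (of_int m + of_int l) * root_vec n i (j + (- m) * int n) r)
        + (\<lambda>r. rat_of_int m / (of_int m + of_int l) * root_vec n i (j + l * int n) r)"
      using comb[of "of_int m" "of_int l"] ml unfolding root_vec_shift_right[OF n]
      by (simp add: fun_eq_iff)
  qed
qed

lemma inversion_in_span:
  assumes ij: "i < j" "w j < w i"
  shows "root_vec n i j \<in> rat_fun.span (covering_roots (\<lambda>x. x \<le> w i - i))"
proof (cases "short_inversion i j")
  case False
  from long_inversion[OF ij this] obtain j0 j1 \<alpha> \<beta>
    where s: "short_inversion i j0" "short_inversion i j1"
    and eq: "root_vec n i j = (\<lambda>r. \<alpha> * root_vec n i j0 r) + (\<lambda>r. \<beta> * root_vec n i j1 r)"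
    by metis
  show ?thesis
    unfolding eq by (intro rat_fun.span_add rat_fun.span_scale short_inversion_in_span s)
qed (rule short_inversion_in_span)

text \<open>Taking \<open>u\<close> leftmost among the positions that obstruct the covering makes
  \<open>(i, u)\<close> a covering, and the rest \<open>(u, j)\<close> involves only smaller
  displacements. If nothing obstructs, \<open>u\<close> is \<open>j\<close>.\<close>

lemma first_covering:
  assumes s: "short_inversion i j"
  obtains u where "covering n w i u" "u \<le> j" "w j \<le> w u"
    "root_vec n i j - root_vec n i u \<in> rat_fun.span (covering_roots (\<lambda>x. x < w i - i))"
proof (cases "covering n w i j")
  case True
  then show thesis by (intro that[of j]) (auto simp: rat_fun.span_zero)
next
  case False
  define P where "P k \<longleftrightarrow> i < k \<and> k < j \<and> w j < w k \<and> w k < w i" for k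
  obtain k where "P k" using False s by (auto simp: covering_def short_inversion_def P_def)
  then obtain u where u: "P u" "\<And>k. P k \<Longrightarrow> nat (u - i) \<le> nat (k - i)"
    using ex_has_least_nat[of P k "\<lambda>k. nat (k - i)"] by blast
  have "covering n w i u"
    unfolding covering_def
  proof (intro conjI allI impI notI)
    fix k assume "i < k \<and> k < u" "w u < w k \<and> w k < w i"
    then have "P k" "nat (k - i) < nat (u - i)" using u(1) by (auto simp: P_def)
    then show False using u(2) by fastforce
  qed (use u(1) s in \<open>auto simp: P_def short_inversion_def\<close>)
  moreover have "root_vec n u j \<in> rat_fun.span (covering_roots (\<lambda>x. x \<le> w u - u))"
    using u(1) by (intro inversion_in_span) (auto simp: P_def)
  moreover have "rat_fun.span (covering_roots (\<lambda>x. x \<le> w u - u))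
      \<subseteq> rat_fun.span (covering_roots (\<lambda>x. x < w i - i))"
    using u(1) by (intro covering_roots_mono) (auto simp: P_def)
  moreover have "root_vec n i j - root_vec n i u = root_vec n u j"
    by (simp add: root_vec_add[of n i u j, symmetric])
  ultimately show thesis using u(1) by (intro that[of u]) (auto simp: P_def)
qed

text \<open>Unless \<open>(k, k + 1)\<close> is itself an inversion, its root is left over when a
  left part, a right part or both are cut off from the root of an inversion, and the parts cut off
  are roots of inversions as well.\<close>

lemma crossed_simple_root_in_span:
  assumes "crossed w k"
  shows "root_vec n k (k + 1) \<in> rat_fun.span (covering_roots (\<lambda>_. True))"
proof -
  let ?S = "rat_fun.span (covering_roots (\<lambda>_. True))"
  have inS: "root_vec n i j \<in> ?S" if "i < j" "w j < w i" for i j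
    using inversion_in_span[OF that] covering_roots_mono[of "\<lambda>x. x \<le> w i - i" "\<lambda>_. True"] by blast
  obtain i j where ij: "i \<le> k" "k + 1 \<le> j" "w j < w i"
    using assms unfolding crossed_def by (metis zless_imp_add1_zle)
  have neq: "w k \<noteq> w (k + 1)" using periodic_bij_inj[OF w] by simp
  consider "w (k + 1) < w k" | "w k < w (k + 1)" "w (k + 1) < w i"
    | "w k < w (k + 1)" "w j < w k" | "w k \<le> w j" "w i \<le> w (k + 1)"
    using neq by linarith
  then show ?thesis
  proof cases
    case 1
    then show ?thesis using inS by simp
  next
    case 2
    then have "i < k" using ij(1) by (cases "i = k") auto
    then have "root_vec n i (k + 1) - root_vec n i k \<in> ?S"
      using 2 by (intro rat_fun.span_diff inS) auto
    then show ?thesis by (simp add: root_vec_add[of n i k "k + 1", symmetric])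
  next
    case 3
    then have "k + 1 < j" using ij(2) by (cases "j = k + 1") auto
    then have "root_vec n k j - root_vec n (k + 1) j \<in> ?S"
      using 3 by (intro rat_fun.span_diff inS) auto
    then show ?thesis by (simp add: root_vec_add[of n k "k + 1" j, symmetric])
  next
    case 4
    then have "i < k" "k + 1 < j"
      using ij by (cases "i = k"; cases "j = k + 1"; auto)+
    then have "root_vec n i j - root_vec n i k - root_vec n (k + 1) j \<in> ?S"
      using 4 ij by (intro rat_fun.span_diff inS) auto
    then show ?thesis
      by (simp add: root_vec_add[of n i k j, symmetric] root_vec_add[of n k "k + 1" j, symmetric])
  qed
qed

text \<open>Every covering is a translate of exactly one in the window; the window starts at the
  position \<open>a\<close> at which two chains of coverings will be compared.\<close>

definition window_coverings :: "int \<Rightarrow> (int \<times> int) set" where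
  "window_coverings a = {(i, j). a \<le> i \<and> i < a + int n \<and> covering n w i j}"

lemma covering_shift:
  assumes c: "covering n w i j"
  shows "covering n w (i + m * int n) (j + m * int n)"
proof -
  have "\<not> (w (j + m * int n) < w k \<and> w k < w (i + m * int n))"
    if k: "i + m * int n < k" "k < j + m * int n" for k
  proof -
    have "w (k - m * int n) = w k - m * int n"
      using periodic_bij_shift[OF w, of k "- m"] by simp
    moreover have "\<not> (w j < w (k - m * int n) \<and> w (k - m * int n) < w i)"
      using c k unfolding covering_def by (meson less_diff_eq diff_less_eq)
    ultimately show ?thesis unfolding periodic_bij_shift[OF w] by linarith
  qed
  then show ?thesis using c unfolding covering_def periodic_bij_shift[OF w] by auto
qed

lemma covering_in_window:
  assumes c: "covering n w i j"
  obtains i' j' where "(i', j') \<in> window_coverings a" "root_vec n i' j' = root_vec n i j"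
    "w i' - i' = w i - i"
proof -
  define m where "m = - ((i - a) div int n)"
  have "i + m * int n - a = (i - a) mod int n"
    by (simp add: m_def minus_div_mult_eq_mod[symmetric])
  moreover have "0 \<le> (i - a) mod int n" "(i - a) mod int n < int n" using n by simp_all
  ultimately have "(i + m * int n, j + m * int n) \<in> window_coverings a"
    using covering_shift[OF c, of m] unfolding window_coverings_def by auto
  then show thesis
    using that root_vec_shift[OF n, of i m j] periodic_bij_shift[OF w, of i m] by simp
qed

text \<open>Modulo the other window roots, those of \<open>(b, d)\<close> and \<open>(c, d)\<close>
  vanish because \<open>b\<close> and \<open>c\<close> have smaller displacement than
  \<open>a\<close>; that of \<open>(a, b)\<close> becomes the root of \<open>(a, u)\<close>, and
  that of \<open>(a, c)\<close> becomes \<open>q\<close> times it with \<open>q\<close> different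
  from 1. Comparing the two decompositions of \<open>(a, d)\<close> gives the claim.\<close>

lemma pattern_root_redundant:
  assumes pos: "a < b" "b < c" "c < d" and val: "w d < w b" "w b < w c" "w c < w a"
    and near: "b - a < int n"
    and hollow: "\<And>k. a < k \<Longrightarrow> k < c \<Longrightarrow> \<not> (w c < w k \<and> w k < w a)"
  obtains u where "(a, u) \<in> window_coverings a"
    "root_vec n a u \<in> rat_fun.span ((\<lambda>(i, j). root_vec n i j) ` (window_coverings a - {(a, u)}))"
proof -
  have "short_inversion a b" using assms by (auto simp: short_inversion_def)
  then obtain u where u: "covering n w a u" "u \<le> b"
    "root_vec n a b - root_vec n a u \<in> rat_fun.span (covering_roots (\<lambda>x. x < w a - a))"
    using first_covering by blast
  define S where "S = rat_fun.span ((\<lambda>(i, j). root_vec n i j) ` (window_coverings a - {(a, u)}))"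
  have low: "rat_fun.span (covering_roots (\<lambda>x. x < w a - a)) \<subseteq> S"
    unfolding S_def
  proof (intro rat_fun.span_mono subsetI)
    fix x assume "x \<in> covering_roots (\<lambda>x. x < w a - a)"
    then obtain i j where x: "x = root_vec n i j" "covering n w i j" "w i - i < w a - a"
      by (auto simp: covering_roots_def)
    obtain i' j' where ij: "(i', j') \<in> window_coverings a" "root_vec n i' j' = root_vec n i j"
      "w i' - i' = w i - i"
      using covering_in_window[OF x(2)] by metis
    then have "(i', j') \<noteq> (a, u)" using x(3) by auto
    then show "x \<in> (\<lambda>(i, j). root_vec n i j) ` (window_coverings a - {(a, u)})"
      using ij x(1) by (intro rev_image_eqI[of "(i', j')"]) auto
  qed
  have lower: "root_vec n i d \<in> S" if "a < i" "i < d" "w d < w i" "w i < w a" for i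
    using inversion_in_span[OF that(2,3)] low
      covering_roots_mono[of "\<lambda>x. x \<le> w i - i" "\<lambda>x. x < w a - a"] that by fastforce
  have other: "root_vec n a v \<in> S" if "covering n w a v" "v \<noteq> u" for v
  proof -
    have "(a, v) \<in> window_coverings a - {(a, u)}"
      using that n by (simp add: window_coverings_def)
    then show ?thesis unfolding S_def
      by (intro rat_fun.span_base rev_image_eqI[of "(a, v)"]) auto
  qed
  have add: "x + y \<in> S" and diff: "x - y \<in> S" and scale: "(\<lambda>r. q * x r) \<in> S"
    if "x \<in> S" "y \<in> S" for x y q
    using that rat_fun.span_add rat_fun.span_diff rat_fun.span_scale unfolding S_def by blast+
  \<comment> \<open>\<open>q\<close> is the total weight in the root of \<open>(a, c)\<close> of the
    first coverings that end at \<open>u\<close>: 0, \<open>\<alpha>\<close> or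
    \<open>\<beta>\<close>. Both weights are below 1, being positive with sum 1.\<close>
  have "\<exists>q. q \<noteq> 1 \<and> root_vec n a c - (\<lambda>r. q * root_vec n a u r) \<in> S"
  proof (cases "short_inversion a c")
    case True
    then have "covering n w a c"
      using hollow by (auto simp: covering_def short_inversion_def)
    then have "root_vec n a c \<in> S" using other u(2) pos by simp
    moreover have "root_vec n a c - (\<lambda>r. 0 * root_vec n a u r) = root_vec n a c"
      by (simp add: fun_eq_iff)
    ultimately show ?thesis by (intro exI[of _ 0]) (simp only:, simp)
  next
    case False
    have "a < c" "w c < w a" using pos val by auto
    from long_inversion[OF this False] obtain c0 c1 \<alpha> \<beta>
      where c: "short_inversion a c0" "short_inversion a c1" "c0 < c" "w c < w c1"
      and \<alpha>: "\<alpha> > 0" "\<beta> > 0" "\<alpha> + \<beta> = 1"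
      and eq: "root_vec n a c = (\<lambda>r. \<alpha> * root_vec n a c0 r) + (\<lambda>r. \<beta> * root_vec n a c1 r)"
      by metis
    from first_covering[OF c(1)] obtain u0 where u0: "covering n w a u0" "u0 \<le> c0"
      "root_vec n a c0 - root_vec n a u0 \<in> S" using low by blast
    from first_covering[OF c(2)] obtain u1 where u1: "covering n w a u1" "w c1 \<le> w u1"
      "root_vec n a c1 - root_vec n a u1 \<in> S" using low by blast
    \<comment> \<open>A common position would lie before \<open>c\<close> and have a value above
      \<open>w c\<close>, which \<open>hollow\<close> excludes.\<close>
    have "u0 \<noteq> u1"
      using hollow[of u0] u0(1,2) u1(1,2) c(3,4) by (auto simp: covering_def)
    have rest: "(\<lambda>r. \<alpha> * (root_vec n a c0 - root_vec n a u0) r) + (\<lambda>r. \<beta> * (root_vec n a c1 - root_vec n a u1) r) \<in> S"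
      using add scale u0(3) u1(3) by blast
    consider "u0 = u" "u1 \<noteq> u" | "u1 = u" "u0 \<noteq> u" | "u0 \<noteq> u" "u1 \<noteq> u"
      using \<open>u0 \<noteq> u1\<close> by blast
    then show ?thesis
    proof cases
      case 1
      have "(\<lambda>r. \<beta> * root_vec n a u1 r) \<in> S" using scale other 1 u1 by blast
      from add[OF rest this] have "root_vec n a c - (\<lambda>r. \<alpha> * root_vec n a u r) \<in> S"
        using 1 by (simp add: eq fun_eq_iff algebra_simps plus_fun_def fun_diff_def)
      then show ?thesis using \<alpha> by (intro exI[of _ \<alpha>]) auto
    next
      case 2
      have "(\<lambda>r. \<alpha> * root_vec n a u0 r) \<in> S" using scale other 2 u0 by blast
      from add[OF rest this] have "root_vec n a c - (\<lambda>r. \<beta> * root_vec n a u r) \<in> S"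
        using 2 by (simp add: eq fun_eq_iff algebra_simps plus_fun_def fun_diff_def)
      then show ?thesis using \<alpha> by (intro exI[of _ \<beta>]) auto
    next
      case 3
      have "(\<lambda>r. \<alpha> * root_vec n a u0 r) + (\<lambda>r. \<beta> * root_vec n a u1 r) \<in> S"
        using add scale other 3 u0 u1 by blast
      from add[OF rest this] have "root_vec n a c - (\<lambda>r. 0 * root_vec n a u r) \<in> S"
        by (simp add: eq fun_eq_iff algebra_simps plus_fun_def fun_diff_def)
      then show ?thesis by (intro exI[of _ 0]) auto
    qed
  qed
  then obtain q where q: "q \<noteq> 1" "root_vec n a c - (\<lambda>r. q * root_vec n a u r) \<in> S" by blast
  \<comment> \<open>The two decompositions of the root of \<open>(a, d)\<close> cancel in
    \<open>y\<close> and leave \<open>1 - q\<close> times the root of \<open>(a, u)\<close>.\<close>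
  define y where "y = (root_vec n a c - (\<lambda>r. q * root_vec n a u r)) + root_vec n c d - root_vec n b d
    - (root_vec n a b - root_vec n a u)"
  have in_S: "root_vec n c d \<in> S" "root_vec n b d \<in> S" "root_vec n a b - root_vec n a u \<in> S"
    using lower[of c] lower[of b] u(3) low pos val by auto
  have "y \<in> S"
    unfolding y_def by (rule diff[OF diff[OF add[OF q(2) in_S(1)] in_S(2)] in_S(3)])
  moreover have "y = (\<lambda>r. (1 - q) * root_vec n a u r)"
  proof
    fix r
    have "root_vec n a c r + root_vec n c d r = root_vec n a b r + root_vec n b d r"
      using fun_cong[OF root_vec_add[of n a c d], of r] fun_cong[OF root_vec_add[of n a b d], of r]
      by simp
    then show "y r = (1 - q) * root_vec n a u r" by (simp add: y_def algebra_simps)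
  qed
  then have "(\<lambda>r. inverse (1 - q) * y r) = root_vec n a u"
    using q(1) by (simp add: fun_eq_iff)
  ultimately have "root_vec n a u \<in> S" using scale by metis
  then show thesis
    using that[of u] u(1) n by (simp add: S_def window_coverings_def)
qed

text \<open>The simple roots of the crossed indices are independent and lie in the span of the
  window roots; one of these is redundant, which makes the inequality strict.\<close>

lemma crossed_less_card_window:
  assumes fin: "finite (window_coverings a)" and u: "(a, u) \<in> window_coverings a"
    and red: "root_vec n a u \<in> rat_fun.span ((\<lambda>(i, j). root_vec n i j) ` (window_coverings a - {(a, u)}))"
  shows "card {k \<in> {..<n}. crossed w (int k)} < card (window_coverings a)"
proof -
  let ?r = "\<lambda>(i, j). root_vec n i j" and ?e = "\<lambda>k. root_vec n (int k) (int k + 1)"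
  let ?T = "?r ` (window_coverings a - {(a, u)})" and ?K = "{k \<in> {..<n}. crossed w (int k)}"
  have "covering_roots (\<lambda>_. True) \<subseteq> insert (root_vec n a u) ?T"
  proof
    fix x assume "x \<in> covering_roots (\<lambda>_. True)"
    then obtain i j where x: "x = root_vec n i j" "covering n w i j" by (auto simp: covering_roots_def)
    then obtain i' j' where "(i', j') \<in> window_coverings a" "root_vec n i' j' = x"
      using covering_in_window[of i j] by metis
    then show "x \<in> insert (root_vec n a u) ?T" by force
  qed
  then have "rat_fun.span (covering_roots (\<lambda>_. True)) \<subseteq> rat_fun.span ?T"
    using rat_fun.span_mono rat_fun.span_redundant[OF red] by metis
  then have "?e ` ?K \<subseteq> rat_fun.span ?T" using crossed_simple_root_in_span by auto
  then have "card (?e ` ?K) \<le> card ?T"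
    using rat_fun.independent_span_bound[of ?T "?e ` ?K"] independent_simple_roots(1)[of ?K n] fin
    by auto
  also have "\<dots> \<le> card (window_coverings a - {(a, u)})"
    using fin by (intro card_image_le) simp
  also have "\<dots> < card (window_coverings a)"
    using fin u by (rule card_Diff1_less)
  finally have "card (?e ` ?K) < card (window_coverings a)" .
  moreover have "?K \<subseteq> {..<n}" by blast
  ultimately show ?thesis
    unfolding card_image[OF independent_simple_roots(2)[OF \<open>?K \<subseteq> {..<n}\<close>]] by simp
qed

text \<open>Induction on \<open>c - a\<close>, keeping \<open>b\<close> and \<open>d\<close>: if
  \<open>b\<close> is too far from \<open>a\<close>, then \<open>a + int n\<close> replaces
  \<open>a\<close>; an obstructing \<open>k\<close> replaces \<open>a\<close> if it lies before
  \<open>b\<close>, and \<open>c\<close> if it lies after \<open>b\<close>.\<close>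

lemma minimal_pattern:
  assumes "a < b" "b < c" "c < d" "w d < w b" "w b < w c" "w c < w a"
  obtains a' b' c' d' where "a' < b'" "b' < c'" "c' < d'"
    "w d' < w b'" "w b' < w c'" "w c' < w a'" "b' - a' < int n"
    "\<And>k. a' < k \<Longrightarrow> k < c' \<Longrightarrow> \<not> (w c' < w k \<and> w k < w a')"
  using assms
proof (induction "nat (c - a)" arbitrary: a c thesis rule: less_induct)
  case less
  have shrink: thesis
    if "nat (c' - a') < nat (c - a)" "a' < b" "b < c'" "c' < d" "w b < w c'" "w c' < w a'" for a' c'
    using less.hyps[OF that(1)] less.prems(1,5) that by blast
  show thesis
  proof (cases "b - a < int n")
    case False
    have "b \<noteq> a + int n"
      using inversion_not_dvd[OF w, of a b] less.prems by auto
    then show thesis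
      using shrink[of c "a + int n"] False less.prems periodic_bij_shift[OF w, of a 1] n by auto
  next
    case near: True
    show thesis
    proof (cases "\<exists>k. a < k \<and> k < c \<and> w c < w k \<and> w k < w a")
      case True
      then obtain k where k: "a < k" "k < c" "w c < w k" "w k < w a" by blast
      then have "k \<noteq> b" using less.prems by auto
      then consider "k < b" | "b < k" by linarith
      then show thesis
      proof cases
        case 1
        then show thesis using shrink[of c k] k less.prems by auto
      next
        case 2
        then show thesis using shrink[of k a] k less.prems by auto
      qed
    next
      case False
      then show thesis using less.prems near by blast
    qed
  qed
qed

end

text \<open>The transposition determines its pair up to translation, and the window fixes the
  translation, so distinct window coverings give distinct coatoms.\<close>

lemma card_window_coverings:
  assumes n: "n \<ge> 3" and w: "w \<in> affine_sym n"
  defines "C \<equiv> {v \<in> affine_sym n. bruhat_le n v w \<and> coxeter_length n w = Suc (coxeter_length n v)}"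
  shows "finite (window_coverings n w a)" "card (window_coverings n w a) \<le> card C"
proof -
  note p = affine_sym_periodic[OF w]
  let ?f = "\<lambda>(i, j). w \<circ> affine_transp n i j"
  have fin: "finite C"
    by (rule finite_subset[OF _ finite_bruhat_interval[of n w]]) (use n in \<open>auto simp: C_def\<close>)
  have image: "?f ` window_coverings n w a \<subseteq> C"
    using covering_coatom[OF n w] n p by (auto simp: C_def window_coverings_def)
  have inj: "inj_on ?f (window_coverings n w a)"
  proof (rule inj_onI, clarify)
    fix i j i' j'
    assume ij: "(i, j) \<in> window_coverings n w a" and ij': "(i', j') \<in> window_coverings n w a"
      and eq: "w \<circ> affine_transp n i j = w \<circ> affine_transp n i' j'"
    have win: "a \<le> i" "i < a + int n" "a \<le> i'" "i' < a + int n"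
      "i < j" "w j < w i" "i' < j'" "w j' < w i'"
      using ij ij' n p by (auto simp: window_coverings_def covering_def)
    note nd = inversion_not_dvd[OF p win(7,8)]
    have "w (affine_transp n i j i) = w (affine_transp n i' j' i)"
      using fun_cong[OF eq, of i] by simp
    then have j: "affine_transp n i' j' i = j"
      using affine_transp_left[of n i j 0] periodic_bij_inj[OF p] by simp
    \<comment> \<open>Only positions in the class of \<open>i'\<close> are moved to the right, and
      \<open>i < j\<close>.\<close>
    obtain k where k: "i = i' + k * int n" "j = j' + k * int n"
      using affine_transp_cases[OF nd, of i] j win by (metis add_less_cancel_right not_less_iff_gr_or_eq)
    have "k = 0"
    proof (rule ccontr)
      assume "k \<noteq> 0"
      then have "k \<ge> 1 \<or> k \<le> - 1" by linarith
      then have "k * int n \<ge> int n \<or> k * int n \<le> - int n"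
        using mult_right_mono[of 1 k "int n"] mult_right_mono[of k "- 1" "int n"] by auto
      then show False using k(1) win by linarith
    qed
    then show "i = i' \<and> j = j'" using k by simp
  qed
  show "finite (window_coverings n w a)" using inj_on_finite[OF inj image fin] .
  show "card (window_coverings n w a) \<le> card C" using card_inj_on_le[OF inj image fin] .
qed

theorem theorem4p1:
  fixes n :: nat and w :: "int \<Rightarrow> int"
  assumes "n \<ge> 3"
    and "w \<in> affine_sym n"
    and "contains_pattern w [4, 2, 3, 1]"
  shows "\<not> palindromic n w"
proof
  assume pal: "palindromic n w"
  have n: "n > 0" "n \<ge> 2" using assms(1) by simp_all
  note p = affine_sym_periodic[OF assms(2)]
  let ?p = "[4, 2, 3, 1] :: nat list"
  obtain i where mono: "strict_mono_on {..<length ?p} (i :: nat \<Rightarrow> int)"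
    and order: "\<forall>x < length ?p. \<forall>y < length ?p. w (i x) < w (i y) \<longleftrightarrow> ?p ! x < ?p ! y"
    using assms(3) unfolding contains_pattern_def by blast
  have "i 0 < i 1" "i 1 < i 2" "i 2 < i 3"
    by (intro strict_mono_onD[OF mono]; simp)+
  moreover have "w (i 3) < w (i 1)" "w (i 1) < w (i 2)" "w (i 2) < w (i 0)"
    using order by (simp_all add: numeral_eq_Suc)
  ultimately obtain a b c d where "a < b" "b < c" "c < d" "w d < w b" "w b < w c" "w c < w a"
    "b - a < int n" "\<And>k. a < k \<Longrightarrow> k < c \<Longrightarrow> \<not> (w c < w k \<and> w k < w a)"
    using minimal_pattern[OF n(1) p] by metis
  then obtain u where "(a, u) \<in> window_coverings n w a"
    "root_vec n a u \<in> rat_fun.span ((\<lambda>(i, j). root_vec n i j) ` (window_coverings n w a - {(a, u)}))"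
    using pattern_root_redundant[OF n(1) p] by metis
  then have "card {k \<in> {..<n}. crossed w (int k)} < card (window_coverings n w a)"
    using crossed_less_card_window[OF n(1) p] card_window_coverings[OF assms(1,2)] by blast
  moreover have "card {v \<in> affine_sym n. bruhat_le n v w \<and> coxeter_length n v = 1}
      \<le> card {k \<in> {..<n}. crossed w (int k)}"
    by (rule surj_card_le[OF _ length_one_elements[OF n(2) assms(2)]]) simp
  \<comment> \<open>Elements of length one are at most as many as crossed indices, these are fewer
    than the window coverings, and those are at most as many as the coatoms, contrary to the
    equality.\<close>
  ultimately show False
    using palindromic_card_eq[OF n(2) pal] card_window_coverings(2)[OF assms(1,2), of a] by linarith
qed

end
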